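(* Let $F\in\mathfrak F$ and let $\mathfrak a:[-1,1]\times\mathbb R_+\to\mathbb R_+$ be a continuous function such that for every $v\ge0$ the function $\mathfrak a(\cdot,v)$ is increasing on $[-1,0]$ and decreasing on $[0,1]$ (monotonicity in the non-strict sense). Then for every $u\in W_1^1(-1,1)$ with $u\ge0$ there exists a sequence of non-negative Lipschitz functions $u_k$ on $[-1,1]$ such that $$u_k\to u\ \text{ in } W_1^1(-1,1)\qquad\text{and}\qquad I(\mathfrak a,u_k)\to I(\mathfrak a,u).$$
   Context: $\mathbb R_+=[0,\infty)$. $\mathfrak F$ is the set of continuous functions $F:\mathbb R_+\times\mathbb R_+\to\mathbb R_+$ that are convex and strictly increasing with respect to the second argument. For $F\in\mathfrak F$, a continuous weight $\mathfrak a:[-1,1]\times\mathbb R_+\to\mathbb R_+$ and a non-negative $u\in W_1^1(-1,1)$ (absolutely continuous functions on $[-1,1]$), $$I(\mathfrak a,u)=\int_{-1}^1 F\big(u(x),\mathfrak a(x,u(x))\,|u'(x)|\big)\,dx\in[0,\infty].$$ *)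

theory Defs
  imports "HOL-Analysis.Analysis"
begin

text \<open>
  Functions on intervals such as \<open>[-1,1]\<close> or \<open>[0,\<infinity>)\<close> are total functions on the reals of which
  only the values on these intervals matter.
\<close>

text \<open>
  The usual epsilon-delta definition. The finite families of non-overlapping compact
  subintervals of \<open>S\<close> are the divisions \<open>D\<close> of subsets of \<open>S\<close>; for an interval \<open>K = [a,b]\<close> in \<open>D\<close>
  we have \<open>Inf K = a\<close> and \<open>Sup K = b\<close>.
\<close>
definition abs_continuous_on :: "real set \<Rightarrow> (real \<Rightarrow> real) \<Rightarrow> bool" where
  "abs_continuous_on S f \<longleftrightarrow>
    (\<forall>\<epsilon>>0. \<exists>\<delta>>0. \<forall>D T. D division_of T \<and> T \<subseteq> S \<and> (\<Sum>K\<in>D. Sup K - Inf K) < \<delta>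
       \<longrightarrow> (\<Sum>K\<in>D. \<bar>f (Sup K) - f (Inf K)\<bar>) < \<epsilon>)"

definition W11 :: "(real \<Rightarrow> real) set" where
  "W11 = {u. abs_continuous_on {-1..1} u}"

text \<open>
  Here and in \<open>energy\<close>, \<open>deriv u x\<close> is the classical derivative, which for \<open>u\<close> in \<open>W11\<close> exists for
  almost every \<open>x\<close> in \<open>(-1,1)\<close>; its values elsewhere, in particular at the end points (where
  they depend on \<open>u\<close> outside \<open>[-1,1]\<close>), only affect a null set.
\<close>
definition W11_norm :: "(real \<Rightarrow> real) \<Rightarrow> ennreal" where
  "W11_norm u = (\<integral>\<^sup>+x\<in>{-1..1}. ennreal (\<bar>u x\<bar> + \<bar>deriv u x\<bar>) \<partial>lebesgue)"

definition W11_tendsto :: "(nat \<Rightarrow> real \<Rightarrow> real) \<Rightarrow> (real \<Rightarrow> real) \<Rightarrow> bool" where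
  "W11_tendsto us u \<longleftrightarrow> (\<lambda>k. W11_norm (\<lambda>x. us k x - u x)) \<longlonglongrightarrow> 0"

definition frakF :: "(real \<Rightarrow> real \<Rightarrow> real) set" where
  "frakF = {F. continuous_on ({0..} \<times> {0..}) (\<lambda>(v, p). F v p) \<and>
               (\<forall>v\<ge>0. \<forall>p\<ge>0. 0 \<le> F v p) \<and>
               (\<forall>v\<ge>0. convex_on {0..} (F v) \<and> strict_mono_on {0..} (F v))}"

definition weights :: "(real \<Rightarrow> real \<Rightarrow> real) set" where
  "weights = {a. continuous_on ({-1..1} \<times> {0..}) (\<lambda>(x, v). a x v) \<and>
                 (\<forall>x\<in>{-1..1}. \<forall>v\<ge>0. 0 \<le> a x v)}"

definition energy ::
  "(real \<Rightarrow> real \<Rightarrow> real) \<Rightarrow> (real \<Rightarrow> real \<Rightarrow> real) \<Rightarrow> (real \<Rightarrow> real) \<Rightarrow> ennreal" where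
  "energy F a u = (\<integral>\<^sup>+x\<in>{-1..1}. ennreal (F (u x) (a x (u x) * \<bar>deriv u x\<bar>)) \<partial>lebesgue)"

end

theory Submission
  imports Defs
begin

text \<open>
  Cutting \<open>u\<close> off or mollifying it gives no control of the energy. Instead, \<open>u\<close> is slowed down where it
  is steep, without changing its values. Write \<open>h\<close> for the derivative of \<open>u\<close> and put, for \<open>k > 0\<close>,
  \<open>\<psi> y = y + (1/k) * (integral of \<bar>h\<bar> from 0 to y)\<close>. This is a strictly increasing map with
  \<open>\<psi>' = w = 1 + \<bar>h\<bar>/k\<close> almost everywhere, it fixes \<open>0\<close> and moves no point towards \<open>0\<close>. Its
  inverse \<open>\<phi>\<close> therefore maps \<open>[-1,1]\<close> into itself, and \<open>v = u \<circ> \<phi>\<close> is defined on \<open>[-1,1]\<close>,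
  non-negative and Lipschitz with constant \<open>k\<close>, since its derivative is \<open>D = (h/w) \<circ> \<phi>\<close>.

  The substitution \<open>x = \<psi> y\<close> turns the energy of \<open>v\<close> into the integral of
  \<open>w * F (u y) (a (\<psi> y) (u y) * \<bar>h y\<bar> / w)\<close> over a part of \<open>[-1,1]\<close>. The weight decreases away from \<open>0\<close>
  and \<open>\<psi>\<close> moves points only away from \<open>0\<close>, so \<open>a (\<psi> y) (u y) \<le> a y (u y)\<close>. As \<open>F v\<close> is increasing and
  convex, \<open>w * F v (p / w) \<le> F v p + (w - 1) * F v 0\<close> for \<open>w \<ge> 1\<close>. Hence the energy of \<open>v\<close> exceeds that
  of \<open>u\<close> by at most a constant times \<open>1/k\<close> (\<open>energy_bound\<close>). The map \<open>\<psi>\<close>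
  may push the end parts of \<open>[-1,1]\<close> outside and these are lost, so \<open>v\<close> may have other end point values.

  For \<open>k\<close> tending to infinity, \<open>\<phi>\<close> tends to the identity uniformly, which gives the convergence of the
  functions; that the derivatives converge in the mean is checked by replacing \<open>h\<close> with a continuous
  function (\<open>derivative_L1_bound\<close>). Along a subsequence the derivatives converge almost everywhere, and
  the lemma of Fatou bounds the energy of \<open>u\<close> by the lower limit of the energies. Together with the
  upper bound this is the claim; if the energy of \<open>u\<close> is infinite, the lower bound alone suffices.

  All this rests on the fundamental theorem of calculus for absolutely continuous functions:
  \<open>abs_continuous_on_density\<close> (such a function is the integral of an integrable \<open>h\<close>) and
  \<open>AE_has_derivative_of_density\<close> (it then has the derivative \<open>h\<close> almost everywhere). For a monotone
  function the first is the theorem of Radon and Nikodym, applied to its Stieltjes measure; the general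
  case follows by writing the function as its positive variation minus a monotone function.
\<close>

section \<open>Absolutely continuous functions have bounded variation\<close>

text \<open>
  \<open>\<delta>\<close> is an admissible answer to \<open>\<epsilon>\<close> in the definition of absolute continuity.
\<close>
definition ac_modulus :: "real set \<Rightarrow> (real \<Rightarrow> real) \<Rightarrow> real \<Rightarrow> real \<Rightarrow> bool" where
  "ac_modulus S f \<epsilon> \<delta> \<longleftrightarrow>
    (\<forall>D T. D division_of T \<and> T \<subseteq> S \<and> (\<Sum>K\<in>D. Sup K - Inf K) < \<delta>
       \<longrightarrow> (\<Sum>K\<in>D. \<bar>f (Sup K) - f (Inf K)\<bar>) < \<epsilon>)"

text \<open>
  Divisions are sets of intervals. Families of intervals given by their end points are more convenient;
  they may contain empty open intervals, and even repeat these.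
\<close>
lemma ac_modulus_intervals:
  fixes x y :: "'i \<Rightarrow> real"
  assumes small: "ac_modulus S f \<epsilon> \<delta>"
    and "finite I" and le: "\<And>i. i \<in> I \<Longrightarrow> x i \<le> y i" and sub: "\<And>i. i \<in> I \<Longrightarrow> {x i..y i} \<subseteq> S"
    and disj: "\<And>i j. i \<in> I \<Longrightarrow> j \<in> I \<Longrightarrow> i \<noteq> j \<Longrightarrow> {x i<..<y i} \<inter> {x j<..<y j} = {}"
    and len: "(\<Sum>i\<in>I. y i - x i) < \<delta>"
  shows "(\<Sum>i\<in>I. \<bar>f (y i) - f (x i)\<bar>) < \<epsilon>"
proof -
  define J where "J = {i\<in>I. x i < y i}"
  have J: "finite J" "J \<subseteq> I" using \<open>finite I\<close> by (auto simp: J_def)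
  have inj: "inj_on (\<lambda>i. {x i..y i}) J"
  proof (rule inj_onI)
    fix i j assume ij: "i \<in> J" "j \<in> J" "{x i..y i} = {x j..y j}"
    then have "x i = x j" "y i = y j" by (auto simp: J_def Icc_eq_Icc)
    moreover have "{x i<..<y i} \<noteq> {}" using ij by (auto simp: J_def)
    ultimately show "i = j" using disj[of i j] ij by (auto simp: J_def)
  qed
  define D where "D = (\<lambda>i. {x i..y i}) ` J"
  have div: "D division_of (\<Union>D)"
  proof (rule division_ofI)
    show "finite D" using J by (simp add: D_def)
    show "K \<noteq> {}" "\<exists>a b. K = cbox a b" if "K \<in> D" for K
      using that by (auto simp: D_def J_def)
    show "interior K1 \<inter> interior K2 = {}" if "K1 \<in> D" "K2 \<in> D" "K1 \<noteq> K2" for K1 K2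
    proof -
      obtain i j where "i \<in> J" "j \<in> J" "K1 = {x i..y i}" "K2 = {x j..y j}" "i \<noteq> j"
        using \<open>K1 \<in> D\<close> \<open>K2 \<in> D\<close> \<open>K1 \<noteq> K2\<close> by (auto simp: D_def)
      then show ?thesis using disj[of i j] by (auto simp only: interior_atLeastAtMost_real J_def)
    qed
  qed auto
  have "(\<Sum>K\<in>D. Sup K - Inf K) = (\<Sum>i\<in>J. y i - x i)"
    unfolding D_def by (subst sum.reindex[OF inj]) (auto simp: J_def intro!: sum.cong)
  also have "\<dots> = (\<Sum>i\<in>I. y i - x i)"
    using le by (intro sum.mono_neutral_left) (auto simp: J_def \<open>finite I\<close> not_less intro: antisym)
  finally have "(\<Sum>K\<in>D. Sup K - Inf K) < \<delta>" using len by simp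
  moreover have "\<Union>D \<subseteq> S" using sub by (auto simp: D_def J_def)
  ultimately have "(\<Sum>K\<in>D. \<bar>f (Sup K) - f (Inf K)\<bar>) < \<epsilon>"
    using small div unfolding ac_modulus_def by blast
  also have "(\<Sum>K\<in>D. \<bar>f (Sup K) - f (Inf K)\<bar>) = (\<Sum>i\<in>J. \<bar>f (y i) - f (x i)\<bar>)"
    unfolding D_def by (subst sum.reindex[OF inj]) (auto simp: J_def intro!: sum.cong)
  also have "\<dots> = (\<Sum>i\<in>I. \<bar>f (y i) - f (x i)\<bar>)"
  proof (intro sum.mono_neutral_left ballI)
    fix i assume "i \<in> I - J"
    then have "x i = y i" using le[of i] by (auto simp: J_def)
    then show "\<bar>f (y i) - f (x i)\<bar> = 0" by (simp only: diff_self abs_zero)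
  qed (use J \<open>finite I\<close> in auto)
  finally show ?thesis .
qed

lemma abs_continuous_onE:
  assumes "abs_continuous_on S f" "\<epsilon> > 0"
  obtains \<delta> where "\<delta> > 0" "ac_modulus S f \<epsilon> \<delta>"
  using assms unfolding abs_continuous_on_def ac_modulus_def by blast

lemma abs_continuous_on_imp_continuous_on:
  assumes "abs_continuous_on {a..b} f"
  shows "continuous_on {a..b} f"
proof (rule continuous_onI)
  fix x and e :: real assume x: "x \<in> {a..b}" and e: "e > 0"
  obtain d where d: "d > 0" and *: "ac_modulus {a..b} f e d"
    by (rule abs_continuous_onE[OF assms e])
  show "\<exists>d>0. \<forall>x'\<in>{a..b}. dist x' x < d \<longrightarrow> dist (f x') (f x) \<le> e"
  proof (intro exI[of _ d] conjI ballI impI d)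
    fix x' assume x': "x' \<in> {a..b}" "dist x' x < d"
    show "dist (f x') (f x) \<le> e"
      using ac_modulus_intervals[OF *, of "{()}" "\<lambda>_. min x x'" "\<lambda>_. max x x'"] x x'
      by (cases "x \<le> x'") (auto simp: dist_real_def)
  qed
qed

lemma abs_continuous_on_diff:
  assumes "abs_continuous_on S f" "abs_continuous_on S g"
  shows "abs_continuous_on S (\<lambda>x. f x - g x)"
  unfolding abs_continuous_on_def
proof (intro allI impI)
  fix e :: real assume "e > 0"
  then have "e/2 > 0" by simp
  from assms(1) this obtain d1 where d1: "d1 > 0" "\<And>D T. D division_of T \<Longrightarrow> T \<subseteq> S \<Longrightarrow> (\<Sum>K\<in>D. Sup K - Inf K) < d1
       \<Longrightarrow> (\<Sum>K\<in>D. \<bar>f (Sup K) - f (Inf K)\<bar>) < e/2"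
    unfolding abs_continuous_on_def by meson
  from assms(2) \<open>e/2 > 0\<close> obtain d2 where d2: "d2 > 0" "\<And>D T. D division_of T \<Longrightarrow> T \<subseteq> S \<Longrightarrow> (\<Sum>K\<in>D. Sup K - Inf K) < d2
       \<Longrightarrow> (\<Sum>K\<in>D. \<bar>g (Sup K) - g (Inf K)\<bar>) < e/2"
    unfolding abs_continuous_on_def by meson
  show "\<exists>\<delta>>0. \<forall>D T. D division_of T \<and> T \<subseteq> S \<and> (\<Sum>K\<in>D. Sup K - Inf K) < \<delta> \<longrightarrow>
          (\<Sum>K\<in>D. \<bar>(f (Sup K) - g (Sup K)) - (f (Inf K) - g (Inf K))\<bar>) < e"
  proof (intro exI[of _ "min d1 d2"] conjI allI impI)
    fix D T assume D: "D division_of T \<and> T \<subseteq> S \<and> (\<Sum>K\<in>D. Sup K - Inf K) < min d1 d2"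
    have "(\<Sum>K\<in>D. \<bar>(f (Sup K) - g (Sup K)) - (f (Inf K) - g (Inf K))\<bar>)
        \<le> (\<Sum>K\<in>D. \<bar>f (Sup K) - f (Inf K)\<bar> + \<bar>g (Sup K) - g (Inf K)\<bar>)"
      by (intro sum_mono) linarith
    also have "\<dots> < e" using d1(2)[of D T] d2(2)[of D T] D by (simp add: sum.distrib)
    finally show "(\<Sum>K\<in>D. \<bar>(f (Sup K) - g (Sup K)) - (f (Inf K) - g (Inf K))\<bar>) < e" .
  qed (use d1 d2 in auto)
qed

text \<open>
  The total ascent of \<open>f\<close> along the first \<open>n\<close> steps of the sequence \<open>t\<close>.
\<close>
definition rise :: "(real \<Rightarrow> real) \<Rightarrow> (nat \<Rightarrow> real) \<Rightarrow> nat \<Rightarrow> real" where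
  "rise f t n = (\<Sum>i<n. max 0 (f (t (Suc i)) - f (t i)))"

text \<open>
  The positive variation of \<open>f\<close> on \<open>[a,b]\<close>. Partitions are monotone sequences, so that refining one by
  a point \<open>c\<close> amounts to composing it with \<open>min c\<close> and \<open>max c\<close>; they need not start at \<open>a\<close> or end at \<open>b\<close>.
\<close>
definition pos_var :: "(real \<Rightarrow> real) \<Rightarrow> real \<Rightarrow> real \<Rightarrow> real" where
  "pos_var f a b = (SUP (t,n)\<in>{t. mono t \<and> range t \<subseteq> {a..b}} \<times> UNIV. rise f t n)"

text \<open>
  A step of \<open>t\<close> that crosses \<open>b\<close> is cut in two at \<open>b\<close>; every other step survives in one of the two
  sequences and becomes constant in the other.
\<close>
lemma rise_split:
  assumes "mono t"
  shows "rise f t n \<le> rise f (\<lambda>i. min (t i) b) n + rise f (\<lambda>i. max (t i) b) n"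
  unfolding rise_def sum.distrib[symmetric]
proof (rule sum_mono)
  fix i
  have "t i \<le> t (Suc i)" using assms by (simp add: mono_def)
  then consider "t (Suc i) \<le> b" | "b \<le> t i" | "t i < b" "b < t (Suc i)" by linarith
  then show "max 0 (f (t (Suc i)) - f (t i)) \<le>
        max 0 (f (min (t (Suc i)) b) - f (min (t i) b)) + max 0 (f (max (t (Suc i)) b) - f (max (t i) b))"
    using \<open>t i \<le> t (Suc i)\<close> by cases (auto simp: min_absorb1 min_absorb2 max_absorb1 max_absorb2)
qed

lemma disjoint_consecutive:
  assumes "mono (t :: nat \<Rightarrow> real)" "i \<noteq> j"
  shows "{t i<..<t (Suc i)} \<inter> {t j<..<t (Suc j)} = {}"
proof -
  have "t (Suc i) \<le> t j \<or> t (Suc j) \<le> t i"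
    using assms by (metis Suc_leI linorder_neqE_nat monoD)
  then show ?thesis by auto
qed

text \<open>
  On an interval that is shorter than the \<open>\<delta>\<close> belonging to \<open>\<epsilon> = 1\<close> the ascent is at most \<open>1\<close>. By
  \<open>rise_split\<close>, bounds on adjacent intervals add up, so that a bisection argument yields a bound on
  \<open>[a,b]\<close>.
\<close>
lemma bounded_rise:
  assumes ac: "abs_continuous_on {a..b} f" and "a \<le> b"
  obtains B where "\<And>t n. mono t \<Longrightarrow> range t \<subseteq> {a..b} \<Longrightarrow> rise f t n \<le> B"
proof -
  obtain d where d: "d > 0" and *: "ac_modulus {a..b} f 1 d"
    by (rule abs_continuous_onE[OF ac zero_less_one])
  define P where "P = (\<lambda>x y. \<exists>B. \<forall>t n. mono t \<longrightarrow> range t \<subseteq> {x..y} \<inter> {a..b} \<longrightarrow> rise f t n \<le> B)"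
  have "P a b"
  proof (induction rule: Bolzano[OF \<open>a \<le> b\<close>])
    case (1 x y z)
    then obtain B C where "\<And>t n. mono t \<Longrightarrow> range t \<subseteq> {x..y} \<inter> {a..b} \<Longrightarrow> rise f t n \<le> B"
      and "\<And>t n. mono t \<Longrightarrow> range t \<subseteq> {y..z} \<inter> {a..b} \<Longrightarrow> rise f t n \<le> C"
      unfolding P_def by metis
    note BC = this
    show ?case unfolding P_def
    proof (intro exI allI impI)
      fix t :: "nat \<Rightarrow> real" and n assume t: "mono t" "range t \<subseteq> {x..z} \<inter> {a..b}"
      show "rise f t n \<le> max 0 B + max 0 C"
      proof (cases "y < a \<or> b < y")
        case True
        then have "range t \<subseteq> {x..y} \<inter> {a..b} \<or> range t \<subseteq> {y..z} \<inter> {a..b}"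
          using t by fastforce
        then show ?thesis using BC t by (smt (verit))
      next
        case False
        have mono_min: "mono (\<lambda>i. min (t i) y)" and mono_max: "mono (\<lambda>i. max (t i) y)"
          using t(1) by (auto intro!: monoI min.mono max.mono dest: monoD)
        have "rise f (\<lambda>i. min (t i) y) n \<le> B"
          by (rule BC(1)) (use mono_min t False \<open>x \<le> y\<close> in \<open>auto simp: image_subset_iff min_le_iff_disj\<close>)
        moreover have "rise f (\<lambda>i. max (t i) y) n \<le> C"
          by (rule BC(2)) (use mono_max t False \<open>y \<le> z\<close> in \<open>auto simp: image_subset_iff le_max_iff_disj\<close>)
        ultimately show ?thesis using rise_split[OF \<open>mono t\<close>, of f n y] by linarith
      qed
    qed
  next
    case (2 x)
    show ?case
    proof (intro exI[of _ d] conjI d allI impI)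
      fix p q assume pq: "p \<le> x \<and> x \<le> q \<and> q - p < d"
      show "P p q" unfolding P_def
      proof (intro exI[of _ 1] allI impI)
        fix t :: "nat \<Rightarrow> real" and n assume t: "mono t" "range t \<subseteq> {p..q} \<inter> {a..b}"
        have "(\<Sum>i<n. t (Suc i) - t i) = t n - t 0" by (rule sum_lessThan_telescope)
        also have "t n \<le> q" "p \<le> t 0" using t by (auto simp: image_subset_iff)
        then have "t n - t 0 < d" using pq by linarith
        finally have len: "(\<Sum>i<n. t (Suc i) - t i) < d" .
        have "rise f t n \<le> (\<Sum>i<n. \<bar>f (t (Suc i)) - f (t i)\<bar>)"
          unfolding rise_def by (intro sum_mono) auto
        also have "\<dots> < 1"
          by (rule ac_modulus_intervals[OF * _ _ _ _ len])
            (use t disjoint_consecutive[OF t(1)] in \<open>auto simp: mono_def image_subset_iff intro: order_trans\<close>)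
        finally show "rise f t n \<le> 1" by simp
      qed
    qed
  qed
  then show ?thesis using that unfolding P_def by auto
qed

lemma pos_var_upper:
  assumes ac: "abs_continuous_on {a..b} f" and "a \<le> b" and "mono t" "range t \<subseteq> {a..b}"
  shows "rise f t n \<le> pos_var f a b"
proof -
  obtain B where B: "\<And>t n. mono t \<Longrightarrow> range t \<subseteq> {a..b} \<Longrightarrow> rise f t n \<le> B"
    using bounded_rise[OF ac \<open>a \<le> b\<close>] by metis
  have "(case (t,n) of (t,n) \<Rightarrow> rise f t n) \<le> pos_var f a b"
    unfolding pos_var_def
    by (intro cSUP_upper) (use assms B in \<open>auto intro!: bdd_aboveI2[where M=B]\<close>)
  then show ?thesis by simp
qed

lemma pos_var_least:
  assumes "a \<le> b" "\<And>t n. mono t \<Longrightarrow> range t \<subseteq> {a..b} \<Longrightarrow> rise f t n \<le> B"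
  shows "pos_var f a b \<le> B"
  unfolding pos_var_def
proof (rule cSUP_least)
  have "(\<lambda>_. a) \<in> {t. mono t \<and> range t \<subseteq> {a..b}}" using \<open>a \<le> b\<close> by (auto simp: mono_def)
  then show "{t. mono t \<and> range t \<subseteq> {a..b}} \<times> (UNIV::nat set) \<noteq> {}" by blast
qed (use assms in auto)

lemma pos_var_approx:
  assumes "a \<le> b" "e > 0"
  obtains t n where "mono t" "range t \<subseteq> {a..b}" "pos_var f a b - e < rise f t n"
proof (rule ccontr)
  assume "\<not> thesis"
  then have "pos_var f a b \<le> pos_var f a b - e"
    using that by (intro pos_var_least \<open>a \<le> b\<close>) (meson not_less)
  then show False using \<open>e > 0\<close> by simp
qed

lemma abs_continuous_on_subset:
  "abs_continuous_on S f \<Longrightarrow> T \<subseteq> S \<Longrightarrow> abs_continuous_on T f"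
  unfolding abs_continuous_on_def by (meson subset_trans)

lemma pos_var_mono:
  assumes "abs_continuous_on {a..z} f" "a \<le> y" "y \<le> z"
  shows "pos_var f a y \<le> pos_var f a z"
proof (rule pos_var_least[OF assms(2)])
  fix t :: "nat \<Rightarrow> real" and n assume "mono t" "range t \<subseteq> {a..y}"
  moreover have "{a..y} \<subseteq> {a..z}" using assms by auto
  ultimately show "rise f t n \<le> pos_var f a z"
    using assms by (intro pos_var_upper) auto
qed

lemma pos_var_triangle:
  assumes "abs_continuous_on {a..z} f" "a \<le> y" "y \<le> z"
  shows "pos_var f a z \<le> pos_var f a y + pos_var f y z"
proof (rule pos_var_least)
  have ac: "abs_continuous_on {a..y} f" "abs_continuous_on {y..z} f"
    by (rule abs_continuous_on_subset[OF assms(1)]; use assms in simp)+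
  fix t :: "nat \<Rightarrow> real" and n assume t: "mono t" "range t \<subseteq> {a..z}"
  have mono_min: "mono (\<lambda>i. min (t i) y)" and mono_max: "mono (\<lambda>i. max (t i) y)"
    using t(1) by (auto intro!: monoI min.mono max.mono dest: monoD)
  have "rise f (\<lambda>i. min (t i) y) n \<le> pos_var f a y"
    by (rule pos_var_upper[OF ac(1)]) (use assms(2,3) t mono_min in
        \<open>auto simp: image_subset_iff min_le_iff_disj\<close>)
  moreover have "rise f (\<lambda>i. max (t i) y) n \<le> pos_var f y z"
    by (rule pos_var_upper[OF ac(2)]) (use assms(2,3) t mono_max in
        \<open>auto simp: image_subset_iff le_max_iff_disj\<close>)
  ultimately show "rise f t n \<le> pos_var f a y + pos_var f y z"
    using rise_split[OF t(1), of f n y] by linarith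
qed (use assms in auto)

text \<open>
  This makes \<open>pos_var f a - f\<close> a monotone function.
\<close>
lemma pos_var_increment:
  assumes ac: "abs_continuous_on {a..z} f" and "a \<le> y" "y \<le> z"
  shows "pos_var f a y + (f z - f y) \<le> pos_var f a z"
proof -
  have "pos_var f a y \<le> pos_var f a z - (f z - f y)"
  proof (rule pos_var_least)
    fix t :: "nat \<Rightarrow> real" and n assume t: "mono t" "range t \<subseteq> {a..y}"
    \<comment> \<open>\<open>t\<close> may stop before \<open>y\<close>, so \<open>y\<close> has to be inserted for the step from \<open>y\<close> to \<open>z\<close> to count in full.\<close>
    define s where "s = (\<lambda>i. if i \<le> n then t i else if i = Suc n then y else z)"
    have le: "t i \<le> y" "a \<le> t i" for i using t by (auto simp: image_subset_iff)
    have "mono s"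
      using t(1) \<open>y \<le> z\<close> le order_trans[OF le(1) \<open>y \<le> z\<close>] by (auto simp: s_def mono_def)
    moreover have "range s \<subseteq> {a..z}"
      using \<open>y \<le> z\<close> \<open>a \<le> y\<close> le order_trans[OF le(1) \<open>y \<le> z\<close>] by (auto simp: s_def image_subset_iff)
    ultimately have "rise f s (Suc (Suc n)) \<le> pos_var f a z"
      using assms by (intro pos_var_upper) auto
    moreover have "rise f s n = rise f t n"
      unfolding rise_def by (intro sum.cong) (auto simp: s_def)
    moreover have "rise f s (Suc (Suc n)) = rise f s n + max 0 (f y - f (t n)) + max 0 (f z - f y)"
      by (simp add: rise_def s_def)
    ultimately show "rise f t n \<le> pos_var f a z - (f z - f y)" by linarith
  qed (use assms in auto)
  then show ?thesis by simp
qed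

lemma division_of_interval_bounds:
  fixes a b :: real
  assumes "D division_of T" "T \<subseteq> {a..b}" "K \<in> D"
  shows "K = {Inf K..Sup K}" "Inf K \<le> Sup K" "a \<le> Inf K" "Sup K \<le> b"
proof -
  obtain x y where xy: "K = {x..y}"
    using division_ofD(4)[OF assms(1,3)] by (auto simp: cbox_interval)
  moreover have "K \<noteq> {}" "K \<subseteq> {a..b}"
    using division_ofD(2,3)[OF assms(1,3)] assms(2) by auto
  ultimately have "x \<le> y" "a \<le> x" "y \<le> b" by auto
  then show "K = {Inf K..Sup K}" "Inf K \<le> Sup K" "a \<le> Inf K" "Sup K \<le> b" using xy by auto
qed

text \<open>
  Within each interval \<open>K\<close> of a short family, the variation is almost attained by a partition of \<open>K\<close>. All
  these partitions together form another family of the same total length, to which the absolute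
  continuity of \<open>f\<close> applies.
\<close>
lemma abs_continuous_on_pos_var:
  assumes ac: "abs_continuous_on {a..b} f"
  shows "abs_continuous_on {a..b} (pos_var f a)"
  unfolding abs_continuous_on_def
proof (intro allI impI)
  fix e :: real assume "e > 0"
  then have "e/2 > 0" by simp
  obtain d where d: "d > 0" and mod: "ac_modulus {a..b} f (e/2) d"
    by (rule abs_continuous_onE[OF ac \<open>e/2 > 0\<close>])
  show "\<exists>\<delta>>0. \<forall>D T. D division_of T \<and> T \<subseteq> {a..b} \<and> (\<Sum>K\<in>D. Sup K - Inf K) < \<delta>
       \<longrightarrow> (\<Sum>K\<in>D. \<bar>pos_var f a (Sup K) - pos_var f a (Inf K)\<bar>) < e"
  proof (intro exI[of _ d] conjI d allI impI)
    fix D T assume D: "D division_of T \<and> T \<subseteq> {a..b} \<and> (\<Sum>K\<in>D. Sup K - Inf K) < d"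
    then have fin: "finite D" by (auto simp: division_of_def)
    have K: "K = {Inf K..Sup K}" "Inf K \<le> Sup K" "a \<le> Inf K" "Sup K \<le> b" if "K \<in> D" for K
      using division_of_interval_bounds[OF _ _ that] D by auto
    \<comment> \<open>The slack per interval; \<open>+ 1\<close> covers the case of no interval.\<close>
    define \<eta> where "\<eta> = e / 2 / (real (card D) + 1)"
    have "\<eta> > 0" using \<open>e > 0\<close> by (simp add: \<eta>_def)
    have "\<exists>t n. mono t \<and> range t \<subseteq> {Inf K..Sup K} \<and> pos_var f (Inf K) (Sup K) - \<eta> < rise f t n"
      if "K \<in> D" for K
      using pos_var_approx[OF K(2)[OF that] \<open>\<eta> > 0\<close>, of f] by metis
    then obtain t n where t: "\<And>K. K \<in> D \<Longrightarrow> mono (t K)" "\<And>K. K \<in> D \<Longrightarrow> range (t K) \<subseteq> {Inf K..Sup K}"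
      "\<And>K. K \<in> D \<Longrightarrow> pos_var f (Inf K) (Sup K) - \<eta> < rise f (t K) (n K)"
      by metis
    have tle: "Inf K \<le> t K i" "t K i \<le> Sup K" "t K i \<le> t K (Suc i)" if "K \<in> D" for K i
      using t(1,2)[OF that] by (auto simp: image_subset_iff mono_def)
    define I where "I = Sigma D (\<lambda>K. {..<n K})"
    have "(\<Sum>(K,i)\<in>I. \<bar>f (t K (Suc i)) - f (t K i)\<bar>) < e/2"
    proof -
      have "(\<Sum>p\<in>I. t (fst p) (Suc (snd p)) - t (fst p) (snd p)) = (\<Sum>K\<in>D. \<Sum>i<n K. t K (Suc i) - t K i)"
        unfolding I_def using fin by (subst sum.Sigma) (auto simp: split_def)
      also have "\<dots> = (\<Sum>K\<in>D. t K (n K) - t K 0)"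
        by (simp only: sum_lessThan_telescope)
      also have "\<dots> \<le> (\<Sum>K\<in>D. Sup K - Inf K)"
        by (intro sum_mono diff_mono) (use tle in auto)
      finally have len: "(\<Sum>p\<in>I. t (fst p) (Suc (snd p)) - t (fst p) (snd p)) < d" using D by simp
      have "(\<Sum>p\<in>I. \<bar>f (t (fst p) (Suc (snd p))) - f (t (fst p) (snd p))\<bar>) < e/2"
      proof (rule ac_modulus_intervals[OF mod _ _ _ _ len])
        show "finite I" using fin by (simp add: I_def)
        show "t (fst p) (snd p) \<le> t (fst p) (Suc (snd p))" if "p \<in> I" for p
          using that tle by (auto simp: I_def)
        show "{t (fst p) (snd p)..t (fst p) (Suc (snd p))} \<subseteq> {a..b}" if "p \<in> I" for p
        proof -
          have "fst p \<in> D" using that by (auto simp: I_def)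
          then show ?thesis using tle(1)[of "fst p" "snd p"] tle(2)[of "fst p" "Suc (snd p)"] K[of "fst p"]
            by auto
        qed
        show "{t (fst p) (snd p)<..<t (fst p) (Suc (snd p))} \<inter> {t (fst q) (snd q)<..<t (fst q) (Suc (snd q))} = {}"
          if "p \<in> I" "q \<in> I" "p \<noteq> q" for p q
        proof (cases "fst p = fst q")
          case True
          then show ?thesis using that t(1)[of "fst p"] disjoint_consecutive[of "t (fst p)" "snd p" "snd q"]
            by (auto simp: I_def prod_eq_iff)
        next
          case False
          have pq: "fst p \<in> D" "fst q \<in> D" using that by (auto simp: I_def)
          have sub: "{t (fst p) (snd p)<..<t (fst p) (Suc (snd p))} \<subseteq> interior (fst p)" if "fst p \<in> D" for p
            using tle(1)[OF that, of "snd p"] tle(2)[OF that, of "Suc (snd p)"]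
            by (subst K(1)[OF that]) auto
          have "interior (fst p) \<inter> interior (fst q) = {}"
            using D pq False by (auto simp: division_of_def)
          then show ?thesis using sub[of p] sub[of q] pq by blast
        qed
      qed
      then show ?thesis by (simp add: split_def)
    qed
    also have "(\<Sum>(K,i)\<in>I. \<bar>f (t K (Suc i)) - f (t K i)\<bar>) = (\<Sum>K\<in>D. \<Sum>i<n K. \<bar>f (t K (Suc i)) - f (t K i)\<bar>)"
      unfolding I_def using fin by (subst sum.Sigma) auto
    finally have bound: "(\<Sum>K\<in>D. \<Sum>i<n K. \<bar>f (t K (Suc i)) - f (t K i)\<bar>) < e/2" .
    have "(\<Sum>K\<in>D. \<bar>pos_var f a (Sup K) - pos_var f a (Inf K)\<bar>)
        \<le> (\<Sum>K\<in>D. (\<Sum>i<n K. \<bar>f (t K (Suc i)) - f (t K i)\<bar>) + \<eta>)"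
    proof (rule sum_mono)
      fix K assume KD: "K \<in> D"
      have acK: "abs_continuous_on {a..Sup K} f" 
        by (rule abs_continuous_on_subset[OF ac]) (use K[OF KD] in auto)
      have "\<bar>pos_var f a (Sup K) - pos_var f a (Inf K)\<bar> \<le> pos_var f (Inf K) (Sup K)"
        using pos_var_mono[OF acK, of "Inf K"] pos_var_triangle[OF acK, of "Inf K"] K[OF KD] by auto
      also have "\<dots> \<le> rise f (t K) (n K) + \<eta>" using t(3)[OF KD] by simp
      also have "rise f (t K) (n K) \<le> (\<Sum>i<n K. \<bar>f (t K (Suc i)) - f (t K i)\<bar>)"
        unfolding rise_def by (intro sum_mono) auto
      finally show "\<bar>pos_var f a (Sup K) - pos_var f a (Inf K)\<bar>
          \<le> (\<Sum>i<n K. \<bar>f (t K (Suc i)) - f (t K i)\<bar>) + \<eta>" by simp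
    qed
    also have "\<dots> < e"
    proof -
      have "real (card D) * \<eta> \<le> e/2"
        using \<open>e > 0\<close> by (simp add: \<eta>_def field_simps)
      then show ?thesis using bound by (simp add: sum.distrib)
    qed
    finally show "(\<Sum>K\<in>D. \<bar>pos_var f a (Sup K) - pos_var f a (Inf K)\<bar>) < e" .
  qed
qed

section \<open>Absolutely continuous functions are integrals\<close>

text \<open>
  A Lebesgue null set is covered by an open set of small measure. The latter is exhausted by finite
  unions of intervals, and by the absolute continuity of \<open>g\<close> these have small measure with respect to
  the Stieltjes measure of \<open>g\<close>. So this measure has a density, which is the required function.
\<close>
lemma mono_abs_continuous_density:
  fixes g :: "real \<Rightarrow> real"
  assumes ac: "abs_continuous_on {a..b} g" and mono: "mono_on {a..b} g" and "a \<le> b"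
  obtains h where "integrable lborel h" "\<And>x y. a \<le> x \<Longrightarrow> x \<le> y \<Longrightarrow> y \<le> b \<Longrightarrow> (h has_integral (g y - g x)) {x..y}"
proof -
  \<comment> \<open>The Stieltjes measure needs a monotone function on the whole line.\<close>
  define G where "G = (\<lambda>x. g (min b (max a x)))"
  have clamp: "min b (max a x) \<in> {a..b}" for x using \<open>a \<le> b\<close> by auto
  have G_eq: "G x = g x" if "x \<in> {a..b}" for x using that by (simp add: G_def)
  have G_mono: "G x \<le> G y" if "x \<le> y" for x y
    unfolding G_def by (rule mono_onD[OF mono]) (use clamp that in \<open>auto simp: min_def max_def\<close>)
  have G_cont: "continuous_on UNIV G"
    unfolding G_def
    by (rule continuous_on_compose2[OF abs_continuous_on_imp_continuous_on[OF ac]])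
       (use clamp in \<open>auto intro!: continuous_intros\<close>)
  define \<mu> where "\<mu> = interval_measure G"
  have \<mu>_Icc: "emeasure \<mu> {x..y} = ennreal (G y - G x)" if "x \<le> y" for x y
    unfolding \<mu>_def by (rule emeasure_interval_measure_Icc[OF that G_mono G_cont])
  have sets_\<mu>[measurable_cong, simp]: "sets \<mu> = sets borel" and space_\<mu>[simp]: "space \<mu> = UNIV"
    by (simp_all add: \<mu>_def)
  define \<nu> where "\<nu> = density \<mu> (indicator {a..b})"
  have sets_\<nu>[measurable_cong, simp]: "sets \<nu> = sets borel" by (simp add: \<nu>_def)
  have \<nu>: "emeasure \<nu> A = emeasure \<mu> ({a..b} \<inter> A)" if "A \<in> sets borel" for A
    using that unfolding \<nu>_def
    by (subst emeasure_density) (auto simp: nn_integral_indicator indicator_inter_arith[symmetric])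
  have "absolutely_continuous lborel \<nu>"
    unfolding absolutely_continuous_def
  proof (rule subsetI)
    fix N :: "real set" assume "N \<in> null_sets lborel"
    then have N[measurable]: "N \<in> sets borel" and N0: "emeasure lborel N = 0" by auto
    have "emeasure \<nu> N \<le> ennreal e" if "e > 0" for e :: real
    proof -
      obtain d where d: "d > 0" and mod: "ac_modulus {a..b} g e d"
        by (rule abs_continuous_onE[OF ac \<open>e > 0\<close>])
      obtain U where U: "open U" "N \<subseteq> U" "emeasure lborel (U - N) < d"
        using outer_regular_lborel[OF N d] by metis
      have "emeasure lborel U = emeasure lborel (U - N)"
        using U(1) N0 by (intro emeasure_Diff_null_set[symmetric]) auto
      with U have Ud: "emeasure lborel U < d" by simp
      obtain \<D> where \<D>: "countable \<D>" "\<And>X. X \<in> \<D> \<Longrightarrow> \<exists>p q. X = cbox p q" "\<Union>\<D> = U"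
        using open_countable_Union_open_cbox[OF U(1)] by metis
      \<comment> \<open>Inserting the empty interval allows an enumeration even if \<open>U\<close> is empty.\<close>
      define c where "c = from_nat_into (insert {} \<D>)"
      have range_c: "range c = insert {} \<D>"
        unfolding c_def using \<D>(1) by (intro range_from_nat_into) auto
      have c: "\<Union>(range c) = U" unfolding range_c using \<D>(3) by simp
      have c_cbox: "\<exists>p q. c i = cbox p q" for i
      proof (cases "c i = {}")
        case True
        then show ?thesis using empty_as_interval by metis
      next
        case False
        then show ?thesis using range_c \<D>(2) by (metis insertE rangeI)
      qed
      define A where "A = (\<lambda>n. \<Union>i<n. c i)"
      have c_meas[measurable]: "c i \<in> sets borel" for i using c_cbox[of i] by (metis borel_closed closed_cbox)
      have small: "emeasure \<nu> (A n) \<le> ennreal e" for n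
      proof -
        obtain D where D: "D division_of \<Union>((\<lambda>i. c i \<inter> cbox a b) ` {..<n})"
        proof (rule elementary_unions_intervals[of "(\<lambda>i. c i \<inter> cbox a b) ` {..<n}"])
          show "finite ((\<lambda>i. c i \<inter> cbox a b) ` {..<n})" by simp
          fix s assume "s \<in> (\<lambda>i. c i \<inter> cbox a b) ` {..<n}"
          then obtain i where "s = c i \<inter> cbox a b" by auto
          moreover obtain p q where "c i = cbox p q" using c_cbox by blast
          ultimately have "s = cbox (max p a) (min q b)" by auto
          then show "\<exists>p q. s = cbox p q" by blast
        qed (rule that)
        have un: "\<Union>((\<lambda>i. c i \<inter> cbox a b) ` {..<n}) = {a..b} \<inter> A n" by (auto simp: A_def)
        note D = D[unfolded un]
        have "finite D" using D by (rule division_of_finite)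
        have K: "K = {Inf K..Sup K}" "Inf K \<le> Sup K" "a \<le> Inf K" "Sup K \<le> b" if "K \<in> D" for K
          by (rule division_of_interval_bounds[OF D Int_lower1 that])+
        have "measure lebesgue K = Sup K - Inf K" if "K \<in> D" for K
          using arg_cong[OF K(1)[OF that], of "measure lebesgue"] K(2)[OF that] by simp
        then have "ennreal (\<Sum>K\<in>D. Sup K - Inf K) = ennreal (\<Sum>K\<in>D. measure lebesgue K)"
          by simp
        also have "\<dots> = ennreal (measure lebesgue ({a..b} \<inter> A n))"
          by (simp add: content_division[OF D])
        also have "\<dots> = emeasure lborel ({a..b} \<inter> A n)"
        proof (subst emeasure_eq_ennreal_measure[symmetric])
          have "emeasure lborel ({a..b} \<inter> A n) \<le> emeasure lborel {a..b}" by (intro emeasure_mono) auto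
          also have "\<dots> < top" by (simp add: emeasure_lborel_Icc_eq)
          finally show "emeasure lebesgue ({a..b} \<inter> A n) \<noteq> top" by (simp add: A_def)
        qed (simp add: A_def)
        also have "\<dots> \<le> emeasure lborel U"
          using c U(1) by (intro emeasure_mono) (auto simp: A_def)
        finally have "ennreal (\<Sum>K\<in>D. Sup K - Inf K) < ennreal d" using Ud by simp
        moreover have "0 \<le> (\<Sum>K\<in>D. Sup K - Inf K)" using K(2) by (intro sum_nonneg) auto
        ultimately have "(\<Sum>K\<in>D. Sup K - Inf K) < d" by (simp add: ennreal_less_iff)
        then have e: "(\<Sum>K\<in>D. \<bar>g (Sup K) - g (Inf K)\<bar>) < e"
          using mod D unfolding ac_modulus_def by blast
        have "emeasure \<nu> (A n) = emeasure \<mu> (\<Union>D)"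
          using division_ofD(6)[OF D] by (simp add: \<nu> A_def)
        also have "\<dots> \<le> (\<Sum>K\<in>D. emeasure \<mu> K)"
        proof -
          have "K \<in> sets \<mu>" if "K \<in> D" for K by (subst K(1)[OF that]) simp
          then show ?thesis
            using emeasure_subadditive_finite[OF \<open>finite D\<close>, of "\<lambda>K. K" \<mu>] by auto
        qed
        also have "\<dots> = (\<Sum>K\<in>D. ennreal \<bar>g (Sup K) - g (Inf K)\<bar>)"
        proof (rule sum.cong[OF refl])
          fix K assume "K \<in> D"
          note K = K[OF this]
          have "emeasure \<mu> K = ennreal (G (Sup K) - G (Inf K))" using arg_cong[OF K(1), of "emeasure \<mu>"] \<mu>_Icc[OF K(2)] by simp
          also have "\<dots> = ennreal \<bar>g (Sup K) - g (Inf K)\<bar>"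
            using G_mono[OF K(2)] K(2-4) by (simp add: G_eq)
          finally show "emeasure \<mu> K = ennreal \<bar>g (Sup K) - g (Inf K)\<bar>" .
        qed
        also have "\<dots> \<le> ennreal e" using e by (subst sum_ennreal) (auto intro: ennreal_leI)
        finally show ?thesis .
      qed
      have "emeasure \<nu> N \<le> emeasure \<nu> (\<Union>n. A n)"
        using U(2) c by (intro emeasure_mono) (auto simp: A_def)
      also have "\<dots> = (SUP n. emeasure \<nu> (A n))"
        by (rule SUP_emeasure_incseq[symmetric]) (auto simp: A_def incseq_def intro: less_le_trans)
      also have "\<dots> \<le> ennreal e" by (intro SUP_least small)
      finally show ?thesis .
    qed
    then have "emeasure \<nu> N = 0"
      by (metis ennreal_le_epsilon add.left_neutral le_zero_eq)
    then show "N \<in> null_sets \<nu>" by auto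
  qed
  then obtain f where f[measurable]: "f \<in> borel_measurable borel" and dens: "density lborel f = \<nu>"
    using sigma_finite_measure.Radon_Nikodym[OF lborel.sigma_finite_measure_axioms, of \<nu>] by auto
  have f_emeasure: "(\<integral>\<^sup>+x\<in>A. f x \<partial>lborel) = emeasure \<mu> ({a..b} \<inter> A)" if "A \<in> sets borel" for A
    using \<nu>[OF that] that by (simp add: dens[symmetric] emeasure_density)
  have "(\<integral>\<^sup>+x. f x \<partial>lborel) = emeasure \<mu> {a..b}"
    using f_emeasure[of UNIV] by simp
  also have "\<dots> < top" using \<mu>_Icc[OF \<open>a \<le> b\<close>] by simp
  finally have fin: "(\<integral>\<^sup>+x. f x \<partial>lborel) < top" .
  then have f_fin: "AE x in lborel. f x \<noteq> top" using nn_integral_PInf_AE[of f lborel] by simp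
  define h where "h = (\<lambda>x. enn2real (f x))"
  have [measurable]: "h \<in> borel_measurable borel" by (simp add: h_def)
  have hf: "AE x in lborel. ennreal (h x) = f x"
    using f_fin by eventually_elim (simp add: h_def less_top)
  have "integrable lborel h"
  proof (rule integrableI_nonneg)
    have "(\<integral>\<^sup>+x. ennreal (h x) \<partial>lborel) = (\<integral>\<^sup>+x. f x \<partial>lborel)"
      by (rule nn_integral_cong_AE[OF hf])
    then show "(\<integral>\<^sup>+x. ennreal (h x) \<partial>lborel) < \<infinity>" using fin by simp
  qed (auto simp: h_def)
  moreover have "(h has_integral (g y - g x)) {x..y}" if xy: "a \<le> x" "x \<le> y" "y \<le> b" for x y
  proof -
    have "(\<integral>\<^sup>+t. ennreal (h t * indicator {x..y} t) \<partial>lborel) = (\<integral>\<^sup>+t\<in>{x..y}. f t \<partial>lborel)"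
      by (rule nn_integral_cong_AE) (use hf in eventually_elim, auto simp: indicator_def)
    also have "\<dots> = emeasure \<mu> {x..y}" using f_emeasure[of "{x..y}"] xy by (simp add: Int_absorb1)
    also have "\<dots> = ennreal (g y - g x)" using \<mu>_Icc[OF xy(2)] xy by (simp add: G_eq)
    finally have "((\<lambda>t. h t * indicator {x..y} t) has_integral (g y - g x)) UNIV"
      using G_mono[OF xy(2)] xy
      by (intro nn_integral_has_integral) (auto simp: h_def G_eq)
    moreover have "(\<lambda>t. h t * indicator {x..y} t) = (\<lambda>t. if t \<in> {x..y} then h t else 0)" by auto
    ultimately show ?thesis by (simp only: has_integral_restrict_UNIV)
  qed
  ultimately show ?thesis using that by blast
qed

theorem abs_continuous_on_density:
  fixes u :: "real \<Rightarrow> real"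
  assumes ac: "abs_continuous_on {a..b} u" and "a \<le> b"
  obtains h where "integrable lborel h" "\<And>x y. a \<le> x \<Longrightarrow> x \<le> y \<Longrightarrow> y \<le> b \<Longrightarrow> (h has_integral (u y - u x)) {x..y}"
proof -
  let ?P = "pos_var u a"
  let ?N = "\<lambda>x. ?P x - u x"
  have acx: "abs_continuous_on {a..x} u" if "x \<le> b" for x
    by (rule abs_continuous_on_subset[OF ac]) (use that in auto)
  have P: "abs_continuous_on {a..b} ?P" by (rule abs_continuous_on_pos_var[OF ac])
  have N: "abs_continuous_on {a..b} ?N" by (rule abs_continuous_on_diff[OF P ac])
  have monoP: "mono_on {a..b} ?P"
    by (intro mono_onI pos_var_mono acx) auto
  have monoN: "mono_on {a..b} ?N"
    using pos_var_increment[OF acx] by (intro mono_onI) (force simp: algebra_simps)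
  obtain p where p: "integrable lborel p"
    "\<And>x y. a \<le> x \<Longrightarrow> x \<le> y \<Longrightarrow> y \<le> b \<Longrightarrow> (p has_integral (?P y - ?P x)) {x..y}"
    using mono_abs_continuous_density[OF P monoP \<open>a \<le> b\<close>] by metis
  obtain n where n: "integrable lborel n"
    "\<And>x y. a \<le> x \<Longrightarrow> x \<le> y \<Longrightarrow> y \<le> b \<Longrightarrow> (n has_integral (?N y - ?N x)) {x..y}"
    using mono_abs_continuous_density[OF N monoN \<open>a \<le> b\<close>] by metis
  show ?thesis
  proof (rule that)
    show "integrable lborel (\<lambda>x. p x - n x)" using p n by simp
    show "((\<lambda>x. p x - n x) has_integral (u y - u x)) {x..y}" if "a \<le> x" "x \<le> y" "y \<le> b" for x y
      using has_integral_diff[OF p(2)[OF that] n(2)[OF that]] by (simp add: algebra_simps)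
  qed
qed

section \<open>Differentiation of integrals\<close>

text \<open>
  Lebesgue's differentiation theorem for averages to the right; averages to the left are obtained by a
  reflection of the real line.
\<close>
lemma integral_right_average:
  fixes h :: "real \<Rightarrow> real"
  assumes "integrable lborel h"
  obtains N where "negligible N"
    "\<And>x e. x \<notin> N \<Longrightarrow> 0 < e \<Longrightarrow> \<exists>d>0. \<forall>t. 0 < t \<and> t < d \<longrightarrow> \<bar>integral {x..x + t} h / t - h x\<bar> < e"
proof -
  have "h integrable_on UNIV"
    by (rule integrable_on_lborel[OF assms])
  then have "h integrable_on cbox a b" for a b
    by (rule integrable_on_subcbox) simp
  from integrable_ccontinuous_explicit[OF this] obtain N where N: "negligible N"
    "\<And>x e. \<lbrakk>x \<notin> N; 0 < e\<rbrakk> \<Longrightarrow> \<exists>d>0. \<forall>t. 0 < t \<and> t < d \<longrightarrow>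
        norm (integral (cbox x (x + t *\<^sub>R One)) h /\<^sub>R t ^ DIM(real) - h x) < e"
    by blast
  show ?thesis
    by (rule that[OF N(1)]) (use N(2) in \<open>simp add: field_simps\<close>)
qed

theorem AE_has_derivative_of_density:
  fixes h U :: "real \<Rightarrow> real"
  assumes h: "integrable lborel h"
    and U: "\<And>x y. a \<le> x \<Longrightarrow> x \<le> y \<Longrightarrow> y \<le> b \<Longrightarrow> (h has_integral (U y - U x)) {x..y}"
  obtains N where "negligible N" "\<And>x. x \<in> {a<..<b} - N \<Longrightarrow> (U has_real_derivative h x) (at x)"
proof -
  obtain N1 where N1: "negligible N1"
    "\<And>x e. x \<notin> N1 \<Longrightarrow> 0 < e \<Longrightarrow> \<exists>d>0. \<forall>t. 0 < t \<and> t < d \<longrightarrow> \<bar>integral {x..x + t} h / t - h x\<bar> < e"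
    using integral_right_average[OF h] by blast
  have h': "integrable lborel (\<lambda>x. h (- x))"
    using lborel_integrable_real_affine[OF h, of "-1" 0] by simp
  obtain N2 where N2: "negligible N2"
    "\<And>x e. x \<notin> N2 \<Longrightarrow> 0 < e \<Longrightarrow> \<exists>d>0. \<forall>t. 0 < t \<and> t < d \<longrightarrow> \<bar>integral {x..x + t} (\<lambda>x. h (- x)) / t - h (- x)\<bar> < e"
    using integral_right_average[OF h'] by blast
  have "negligible (N1 \<union> uminus ` N2)"
    using N1 N2 by (intro negligible_Un negligible_differentiable_image_negligible[OF order_refl])
      (auto simp: differentiable_on_def)
  moreover have "(U has_real_derivative h x) (at x)" if x: "x \<in> {a<..<b} - (N1 \<union> uminus ` N2)" for x
    unfolding DERIV_def
  proof (rule LIM_I)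
    fix e :: real assume "e > 0"
    obtain d1 where d1: "d1 > 0" "\<And>t. 0 < t \<Longrightarrow> t < d1 \<Longrightarrow> \<bar>integral {x..x + t} h / t - h x\<bar> < e"
      using N1(2)[of x e] x \<open>e > 0\<close> by auto
    have "- x \<notin> N2" using x by force
    then obtain d2 where d2: "d2 > 0"
      "\<And>t. 0 < t \<Longrightarrow> t < d2 \<Longrightarrow> \<bar>integral {-x..-x + t} (\<lambda>x. h (- x)) / t - h x\<bar> < e"
      using N2(2)[of "-x" e] \<open>e > 0\<close> by auto
    define d where "d = min (min d1 d2) (min (x - a) (b - x))"
    show "\<exists>s>0. \<forall>t::real. t \<noteq> 0 \<and> norm (t - 0) < s \<longrightarrow> norm ((U (x + t) - U x) / t - h x) < e"
    proof (intro exI[of _ d] conjI allI impI)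
      show "d > 0" using d1 d2 x by (simp add: d_def)
      fix t :: real assume t: "t \<noteq> 0 \<and> norm (t - 0) < d"
      show "norm ((U (x + t) - U x) / t - h x) < e"
      proof (cases "t > 0")
        case True
        then have "integral {x..x + t} h = U (x + t) - U x"
          using t x by (intro integral_unique U) (auto simp: d_def)
        then show ?thesis using d1(2)[of t] True t by (simp add: d_def)
      next
        case False
        then have "t < 0" using t by simp
        have "integral {-x..-x + (-t)} (\<lambda>x. h (- x)) = integral {x + t..x} h"
          using Henstock_Kurzweil_Integration.integral_reflect_real[of x "x+t" h] by simp
        also have "\<dots> = U x - U (x + t)"
          using t x \<open>t < 0\<close> by (intro integral_unique U) (auto simp: d_def)
        finally show ?thesis using d2(2)[of "-t"] \<open>t < 0\<close> t by (simp add: d_def field_simps)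
      qed
    qed
  qed
  ultimately show ?thesis using that by blast
qed

section \<open>Slowing a function down by a change of its argument\<close>

text \<open>
  The setting of the construction: \<open>u\<close> is the integral of \<open>h\<close> on \<open>[-1,1]\<close>.
\<close>
locale function_with_density =
  fixes u h :: "real \<Rightarrow> real"
  assumes h_integrable: "integrable lborel h"
    and u_integral: "\<And>x y. -1 \<le> x \<Longrightarrow> x \<le> y \<Longrightarrow> y \<le> 1 \<Longrightarrow> (h has_integral (u y - u x)) {x..y}"
begin

lemma h_measurable[measurable]: "h \<in> borel_measurable borel"
  using borel_measurable_integrable[OF h_integrable] by simp

lemma abs_h_integrable: "(\<lambda>t. \<bar>h t\<bar>) integrable_on {x..y}"
proof -
  have "(\<lambda>t. \<bar>h t\<bar>) integrable_on UNIV"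
    by (rule integrable_on_lborel) (use h_integrable in simp)
  then show ?thesis by (rule integrable_on_subinterval) simp
qed

lemma h_absolutely_integrable: "h absolutely_integrable_on {x..y}"
proof -
  have "h integrable_on UNIV" by (rule integrable_on_lborel[OF h_integrable])
  then have "h integrable_on {x..y}" by (rule integrable_on_subinterval) simp
  then show ?thesis using abs_h_integrable by (simp add: absolutely_integrable_on_def)
qed

text \<open>
  As \<open>u\<close> is the integral of \<open>h\<close>, this is the total variation of \<open>u\<close> on \<open>[-1,y]\<close>.
\<close>
definition V :: "real \<Rightarrow> real" where "V y = integral {-1..y} (\<lambda>t. \<bar>h t\<bar>)"

lemma V_integral:
  assumes "-1 \<le> x" "x \<le> y"
  shows "((\<lambda>t. \<bar>h t\<bar>) has_integral (V y - V x)) {x..y}"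
proof -
  have "V x + integral {x..y} (\<lambda>t. \<bar>h t\<bar>) = V y"
    unfolding V_def by (rule Henstock_Kurzweil_Integration.integral_combine[OF assms abs_h_integrable])
  then have "integral {x..y} (\<lambda>t. \<bar>h t\<bar>) = V y - V x" by simp
  then show ?thesis using abs_h_integrable[of x y] by (simp add: has_integral_iff)
qed

lemma V_mono: "-1 \<le> x \<Longrightarrow> x \<le> y \<Longrightarrow> V x \<le> V y"
  using has_integral_nonneg[OF V_integral, of x y] by simp

lemma V_bounds: "-1 \<le> x \<Longrightarrow> x \<le> 1 \<Longrightarrow> 0 \<le> V x \<and> V x \<le> V 1"
  using V_mono[of "-1" x] V_mono[of x 1] by (simp add: V_def)

lemma u_le_V:
  assumes "-1 \<le> x" "x \<le> y" "y \<le> 1"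
  shows "\<bar>u y - u x\<bar> \<le> V y - V x"
proof -
  have "norm (integral {x..y} h) \<le> integral {x..y} (\<lambda>t. \<bar>h t\<bar>)"
    by (rule integral_norm_bound_integral)
      (use u_integral[OF assms] abs_h_integrable in \<open>auto simp: has_integral_iff\<close>)
  then show ?thesis
    using u_integral[OF assms] V_integral[OF assms(1,2)] by (simp add: has_integral_iff)
qed

lemma continuous_on_V: "continuous_on {-1..1} V"
  unfolding V_def[abs_def] by (rule indefinite_integral_continuous_1[OF abs_h_integrable])

lemma continuous_on_u: "continuous_on {-1..1} u"
proof -
  have "continuous_on {-1..1} (\<lambda>y. u (-1) + integral {-1..y} h)"
    using h_absolutely_integrable
    by (intro continuous_intros indefinite_integral_continuous_1)
      (auto simp: absolutely_integrable_on_def)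
  then show ?thesis
    by (rule continuous_on_eq) (use u_integral in \<open>auto simp: has_integral_iff\<close>)
qed

end

locale reparametrization = function_with_density +
  fixes k :: real
  assumes k_pos: "k > 0"
begin

definition w :: "real \<Rightarrow> real" where "w y = 1 + \<bar>h y\<bar> / k"

text \<open>
  Read as a time, \<open>\<psi>\<close> spends \<open>w y\<close> per unit length at \<open>y\<close>, which is at least \<open>1\<close> and enough to lower the
  speed \<open>\<bar>h y\<bar>\<close> of \<open>u\<close> to at most \<open>k\<close>. The normalisation at \<open>0\<close> is dictated by the weight, which is largest there.
\<close>
definition \<psi> :: "real \<Rightarrow> real" where "\<psi> y = y + (V y - V 0) / k"

definition \<phi> :: "real \<Rightarrow> real" where "\<phi> = inv_into {-1..1} \<psi>"

lemma w_ge_1: "w y \<ge> 1"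
  using k_pos by (simp add: w_def)

lemma \<psi>_integral:
  assumes "-1 \<le> x" "x \<le> y"
  shows "(w has_integral (\<psi> y - \<psi> x)) {x..y}"
proof -
  have "((\<lambda>t. 1 + \<bar>h t\<bar> / k) has_integral ((y - x) + (V y - V x) / k)) {x..y}"
    using has_integral_const_real[of "1::real" x y] assms
    by (intro has_integral_add has_integral_divide V_integral) auto
  moreover have "(y - x) + (V y - V x) / k = \<psi> y - \<psi> x" by (simp add: \<psi>_def diff_divide_distrib)
  ultimately show ?thesis by (simp add: w_def[abs_def])
qed

lemma \<psi>_increment: "-1 \<le> x \<Longrightarrow> x \<le> y \<Longrightarrow> y - x + (V y - V x) / k = \<psi> y - \<psi> x"
  by (simp add: \<psi>_def diff_divide_distrib)

lemma \<psi>_expanding: "-1 \<le> x \<Longrightarrow> x \<le> y \<Longrightarrow> y - x \<le> \<psi> y - \<psi> x"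
proof -
  assume xy: "-1 \<le> x" "x \<le> y"
  then have "0 \<le> (V y - V x) / k" using V_mono[of x y] k_pos by simp
  then show ?thesis using \<psi>_increment[OF xy] by linarith
qed

lemma inj_on_\<psi>: "inj_on \<psi> {-1..1}"
proof (rule inj_onI)
  fix x y assume "x \<in> {-1..1}" "y \<in> {-1..1}" "\<psi> x = \<psi> y"
  then show "x = y" using \<psi>_expanding[of x y] \<psi>_expanding[of y x] unfolding atLeastAtMost_iff by linarith
qed

lemma continuous_on_\<psi>: "continuous_on {-1..1} \<psi>"
  unfolding \<psi>_def[abs_def] using k_pos by (intro continuous_intros continuous_on_V) auto

lemma \<psi>_0: "\<psi> 0 = 0"
  by (simp add: \<psi>_def)

lemma \<psi>_ge: "0 \<le> y \<Longrightarrow> y \<le> \<psi> y"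
  using \<psi>_expanding[of 0 y] by (simp add: \<psi>_0)

lemma \<psi>_le: "-1 \<le> y \<Longrightarrow> y \<le> 0 \<Longrightarrow> \<psi> y \<le> y"
  using \<psi>_expanding[of y 0] by (simp add: \<psi>_0)

lemma \<psi>_near: "-1 \<le> y \<Longrightarrow> y \<le> 1 \<Longrightarrow> \<bar>\<psi> y - y\<bar> \<le> V 1 / k"
proof -
  assume "-1 \<le> y" "y \<le> 1"
  then have "\<bar>V y - V 0\<bar> \<le> V 1" using V_bounds[of y] V_bounds[of 0] by auto
  then show ?thesis using k_pos by (simp add: \<psi>_def divide_right_mono)
qed

text \<open>
  This is where \<open>\<psi> (-1) \<le> -1\<close> and \<open>\<psi> 1 \<ge> 1\<close> are needed.
\<close>
lemma \<psi>_onto: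
  assumes "x \<in> {-1..1}"
  shows "x \<in> \<psi> ` {-1..1}"
proof -
  have "\<psi> (-1) \<le> x" "x \<le> \<psi> 1" using assms \<psi>_ge[of 1] \<psi>_le[of "-1"] by auto
  then obtain y where "-1 \<le> y" "y \<le> 1" "\<psi> y = x"
    using IVT'[of \<psi> "-1" x 1] continuous_on_\<psi> by auto
  then show ?thesis by (intro image_eqI[of _ _ y]) auto
qed

lemma \<phi>_in: "x \<in> {-1..1} \<Longrightarrow> \<phi> x \<in> {-1..1}"
  unfolding \<phi>_def by (rule inv_into_into[OF \<psi>_onto])

lemma \<psi>_\<phi>: "x \<in> {-1..1} \<Longrightarrow> \<psi> (\<phi> x) = x"
  unfolding \<phi>_def by (rule f_inv_into_f[OF \<psi>_onto])

lemma \<phi>_\<psi>: "y \<in> {-1..1} \<Longrightarrow> \<phi> (\<psi> y) = y"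
  unfolding \<phi>_def by (rule inv_into_f_f[OF inj_on_\<psi>])

lemma \<phi>_mono:
  assumes "x \<in> {-1..1}" "y \<in> {-1..1}" "x \<le> y"
  shows "\<phi> x \<le> \<phi> y"
  using \<psi>_expanding[of "\<phi> y" "\<phi> x"] \<phi>_in[OF assms(1)] \<phi>_in[OF assms(2)] \<psi>_\<phi>[OF assms(1)] \<psi>_\<phi>[OF assms(2)] assms(3)
  unfolding atLeastAtMost_iff by linarith

lemma \<phi>_lipschitz: "1-lipschitz_on {-1..1} \<phi>"
proof (rule lipschitz_on_leI)
  fix x y :: real assume xy: "x \<in> {-1..1}" "y \<in> {-1..1}" "x \<le> y"
  have "\<phi> y - \<phi> x \<le> \<psi> (\<phi> y) - \<psi> (\<phi> x)"
    using \<phi>_in[OF xy(1)] \<phi>_mono[OF xy] by (intro \<psi>_expanding) auto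
  then show "dist (\<phi> x) (\<phi> y) \<le> 1 * dist x y"
    using \<phi>_mono[OF xy] \<psi>_\<phi>[OF xy(1)] \<psi>_\<phi>[OF xy(2)] by (simp add: dist_real_def)
qed simp

lemma continuous_on_\<phi>: "continuous_on {-1..1} \<phi>"
  by (rule lipschitz_on_continuous_on[OF \<phi>_lipschitz])

lemma \<phi>_near: "x \<in> {-1..1} \<Longrightarrow> \<bar>\<phi> x - x\<bar> \<le> V 1 / k"
  using \<psi>_near[of "\<phi> x"] \<phi>_in[of x] \<psi>_\<phi>[of x] by (auto simp: abs_minus_commute)

text \<open>
  \<open>V\<close> grows at most \<open>k\<close> times as fast as \<open>\<psi>\<close>, because \<open>V / k\<close> is one of the two increasing summands of
  \<open>\<psi>\<close>; and \<open>u\<close> varies no more than \<open>V\<close>.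
\<close>
lemma u_\<phi>_lipschitz: "k-lipschitz_on {-1..1} (\<lambda>x. u (\<phi> x))"
proof (rule lipschitz_on_leI)
  fix x y :: real assume xy: "x \<in> {-1..1}" "y \<in> {-1..1}" "x \<le> y"
  have b: "-1 \<le> \<phi> x" "\<phi> x \<le> \<phi> y" "\<phi> y \<le> 1"
    using \<phi>_in[OF xy(1)] \<phi>_in[OF xy(2)] \<phi>_mono[OF xy] by auto
  have "\<bar>u (\<phi> y) - u (\<phi> x)\<bar> \<le> V (\<phi> y) - V (\<phi> x)" by (rule u_le_V[OF b])
  also have "\<dots> \<le> k * (\<psi> (\<phi> y) - \<psi> (\<phi> x))"
    using b k_pos by (simp add: \<psi>_increment[symmetric] field_simps)
  also have "\<dots> = k * (y - x)" using \<psi>_\<phi> xy by simp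
  finally show "dist (u (\<phi> x)) (u (\<phi> y)) \<le> k * dist x y"
    using xy(3) by (simp add: dist_real_def abs_minus_commute)
qed (use k_pos in simp)

text \<open>
  The points at which the substitution \<open>x = \<psi> y\<close> is performed.
\<close>
definition Z :: "real set" where
  "Z = {y \<in> {-1<..<1}. \<psi> y \<in> {-1<..<1} \<and>
     (\<psi> has_real_derivative w y) (at y) \<and> (u has_real_derivative h y) (at y)}"

lemma Z_sub: "y \<in> Z \<Longrightarrow> y \<in> {-1..1} \<and> \<psi> y \<in> {-1..1}"
  by (auto simp: Z_def)

lemma w_integrable: "integrable lborel (\<lambda>t. indicator {-1..1} t * w t)"
proof -
  have "integrable lborel (\<lambda>t. indicator {-1..1} t *\<^sub>R \<bar>h t\<bar>)"
    by (rule integrable_mult_indicator) (use h_integrable in auto)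
  then have "integrable lborel (\<lambda>t. indicator {-1..1} t + (indicator {-1..1} t * \<bar>h t\<bar>) / k :: real)"
    by (intro Bochner_Integration.integrable_add integrable_divide) auto
  then show ?thesis by (simp add: w_def distrib_left)
qed

lemma good_points:
  obtains N where "negligible N"
    "\<And>y. y \<in> {-1<..<1} - N \<Longrightarrow> (\<psi> has_real_derivative w y) (at y)"
    "\<And>y. y \<in> {-1<..<1} - N \<Longrightarrow> (u has_real_derivative h y) (at y)"
proof -
  obtain N1 where N1: "negligible N1" "\<And>y. y \<in> {-1<..<1} - N1 \<Longrightarrow> (u has_real_derivative h y) (at y)"
    using AE_has_derivative_of_density[OF h_integrable u_integral] by blast
  have w_int: "((\<lambda>t. indicator {-1..1} t * w t) has_integral (\<psi> y - \<psi> x)) {x..y}" if "-1 \<le> x" "x \<le> y" "y \<le> 1" for x y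
    using \<psi>_integral[OF that(1,2)] by (rule has_integral_eq[rotated]) (use that in auto)
  obtain N2 where N2: "negligible N2"
    "\<And>y. y \<in> {-1<..<1} - N2 \<Longrightarrow> (\<psi> has_real_derivative (indicator {-1..1} y * w y)) (at y)"
    using AE_has_derivative_of_density[OF w_integrable w_int] by blast
  show ?thesis
  proof (rule that[of "N1 \<union> N2"])
    show "negligible (N1 \<union> N2)" using N1(1) N2(1) by (rule negligible_Un)
    fix y :: real assume y: "y \<in> {-1<..<1} - (N1 \<union> N2)"
    then show "(u has_real_derivative h y) (at y)" using N1(2)[of y] by simp
    from y show "(\<psi> has_real_derivative w y) (at y)" using N2(2)[of y] by simp
  qed
qed

text \<open>
  The image under \<open>\<psi>\<close> of almost all of \<open>[-1,1]\<close> has the measure \<open>integral of \<psi>' = \<psi> 1 - \<psi> (-1)\<close>. This is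
  the length of the interval \<open>[\<psi> (-1), \<psi> 1]\<close>, so that almost no point of the interval is missed.
\<close>
lemma Z_complement: "Z \<in> sets lebesgue" "negligible ({-1..1} - \<psi> ` Z)"
proof -
  obtain N where N: "negligible N"
    "\<And>y. y \<in> {-1<..<1} - N \<Longrightarrow> (\<psi> has_real_derivative w y) (at y)"
    "\<And>y. y \<in> {-1<..<1} - N \<Longrightarrow> (u has_real_derivative h y) (at y)"
    using good_points by blast
  define Y where "Y = {-1<..<1} - N"
  have Y: "Y \<in> sets lebesgue"
    unfolding Y_def by (intro sets.Diff negligible_imp_sets[OF N(1)]) auto
  \<comment> \<open>\<open>Z\<close> is an open interval up to a null set, hence measurable.\<close>
  define J where "J = {-1<..<1} \<inter> {\<phi> (-1)<..<\<phi> 1}"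
  have J: "y \<in> J \<longleftrightarrow> y \<in> {-1<..<1} \<and> \<psi> y \<in> {-1<..<1}" for y
  proof (cases "y \<in> {-1<..<1}")
    case True
    have \<phi>1: "\<phi> (-1) \<in> {-1..1}" "\<phi> 1 \<in> {-1..1}" "\<psi> (\<phi> (-1)) = -1" "\<psi> (\<phi> 1) = 1"
      using \<phi>_in \<psi>_\<phi> by auto
    have "\<phi> (-1) < y \<longleftrightarrow> -1 < \<psi> y"
      using \<psi>_expanding[of "\<phi> (-1)" y] \<psi>_expanding[of y "\<phi> (-1)"] \<phi>1 True
      unfolding atLeastAtMost_iff greaterThanLessThan_iff by linarith
    moreover have "y < \<phi> 1 \<longleftrightarrow> \<psi> y < 1"
      using \<psi>_expanding[of "\<phi> 1" y] \<psi>_expanding[of y "\<phi> 1"] \<phi>1 True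
      unfolding atLeastAtMost_iff greaterThanLessThan_iff by linarith
    ultimately show ?thesis using True by (auto simp: J_def)
  qed (auto simp: J_def)
  have Z_eq: "Z = J - {y \<in> N. y \<notin> Z}"
    using N(2,3) J by (auto simp: Z_def)
  have "negligible {y \<in> N. y \<notin> Z}" by (rule negligible_subset[OF N(1)]) auto
  then show "Z \<in> sets lebesgue"
    by (subst Z_eq, intro sets.Diff, simp add: J_def, rule negligible_imp_sets)
  have inj: "inj_on \<psi> Y" by (rule inj_on_subset[OF inj_on_\<psi>]) (auto simp: Y_def)
  have der: "(\<psi> has_real_derivative w y) (at y within Y)" if "y \<in> Y" for y
    using N(2)[of y] that by (auto simp: Y_def intro: DERIV_subset)
  have w_int: "(w has_integral (\<psi> 1 - \<psi> (-1))) {-1..1}" by (rule \<psi>_integral) auto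
  have w_abs: "w absolutely_integrable_on {-1..1}"
  proof -
    have "0 \<le> w x" for x using w_ge_1[of x] by simp
    then show ?thesis using w_int by (subst absolutely_integrable_on_iff_nonneg) auto
  qed
  have neg1: "negligible ({-1..1} - Y)"
    by (rule negligible_subset[of "insert (-1) (insert 1 N)"]) (use N(1) in \<open>auto simp: Y_def\<close>)
  have neg1': "negligible (Y - {-1..1})"
    by (rule negligible_subset[of "{}"]) (auto simp: Y_def)
  have "w absolutely_integrable_on Y"
    by (rule absolutely_integrable_spike_set[OF w_abs]) (rule negligible_subset[OF neg1] negligible_subset[OF neg1'], blast)+
  moreover have "integral Y w = \<psi> 1 - \<psi> (-1)"
  proof -
    have "integral {-1..1} w = integral Y w"
      by (rule integral_spike_set) (rule negligible_subset[OF neg1] negligible_subset[OF neg1'], blast)+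
    then show ?thesis using w_int by (simp add: has_integral_iff)
  qed
  moreover have "\<bar>w y\<bar> * 1 = w y" for y using w_ge_1[of y] by simp
  ultimately have "(\<lambda>x. 1::real) absolutely_integrable_on (\<psi> ` Y)" "integral (\<psi> ` Y) (\<lambda>x. 1) = \<psi> 1 - \<psi> (-1)"
    using has_absolute_integral_change_of_variables_1'[OF Y der inj, of "\<lambda>_. 1" "\<psi> 1 - \<psi> (-1)"] by auto
  then have im: "\<psi> ` Y \<in> lmeasurable" "measure lebesgue (\<psi> ` Y) = \<psi> 1 - \<psi> (-1)"
    by (auto simp: lmeasurable_iff_integrable_on absolutely_integrable_on_def lmeasure_integral)
  have le: "\<psi> (-1) \<le> \<psi> 1" using \<psi>_ge[of 1] \<psi>_le[of "-1"] by simp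
  have sub: "\<psi> ` Y \<subseteq> {\<psi> (-1)..\<psi> 1}"
  proof
    fix x assume "x \<in> \<psi> ` Y"
    then obtain y where "x = \<psi> y" "-1 < y" "y < 1" by (auto simp: Y_def)
    then show "x \<in> {\<psi> (-1)..\<psi> 1}" using \<psi>_expanding[of "-1" y] \<psi>_expanding[of y 1] by auto
  qed
  have "measure lebesgue ({\<psi> (-1)..\<psi> 1} - \<psi> ` Y) = 0"
    using measurable_measure_Diff[OF _ _ sub, of lebesgue] im le by (simp add: fmeasurableD)
  then have neg: "negligible ({\<psi> (-1)..\<psi> 1} - \<psi> ` Y)"
    using im by (subst negligible_iff_measure0) (auto intro: fmeasurable.Diff)
  show "negligible ({-1..1} - \<psi> ` Z)"
  proof (rule negligible_subset)
    show "negligible (insert (-1) (insert 1 ({\<psi> (-1)..\<psi> 1} - \<psi> ` Y)))" using neg by simp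
    show "{-1..1} - \<psi> ` Z \<subseteq> insert (-1) (insert 1 ({\<psi> (-1)..\<psi> 1} - \<psi> ` Y))"
    proof
      fix x assume x: "x \<in> {-1..1} - \<psi> ` Z"
      have "x \<in> {\<psi> (-1)..\<psi> 1}" using x \<psi>_ge[of 1] \<psi>_le[of "-1"] by auto
      moreover have "x = -1 \<or> x = 1" if "y \<in> Y" "x = \<psi> y" for y
        using that x N(2,3) by (force simp: Y_def Z_def)
      ultimately show "x \<in> insert (-1) (insert 1 ({\<psi> (-1)..\<psi> 1} - \<psi> ` Y))" by auto
    qed
  qed
qed

text \<open>
  The substitution in the form in which it is used below: a bound \<open>b\<close> for the transformed integrand \<open>G\<close>
  on all of \<open>[-1,1]\<close> gives the integrability of \<open>f\<close> and a bound for its integral. Measurability is only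
  required of \<open>G\<close>, which is known explicitly in terms of \<open>h\<close>.
\<close>
lemma change_of_variables:
  assumes G: "G \<in> borel_measurable (lebesgue_on {-1..1})"
    and b: "b integrable_on {-1..1}" "\<And>y. y \<in> {-1..1} \<Longrightarrow> 0 \<le> b y"
    and fG: "\<And>y. y \<in> Z \<Longrightarrow> w y * f (\<psi> y) = G y" and Gb: "\<And>y. y \<in> Z \<Longrightarrow> \<bar>G y\<bar> \<le> b y"
  shows "f absolutely_integrable_on {-1..1} \<and> integral {-1..1} (\<lambda>x. \<bar>f x\<bar>) \<le> integral {-1..1} b"
proof -
  have Z: "Z \<in> sets lebesgue" "Z \<subseteq> {-1..1}" using Z_complement(1) Z_sub by auto
  have bZ: "b absolutely_integrable_on Z"
    by (rule set_integrable_subset[OF _ Z]) (use b absolutely_integrable_on_iff_nonneg[of "{-1..1}" b] in blast)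
  have "G \<in> borel_measurable (lebesgue_on Z)"
    by (rule measurable_restrict_mono[OF G Z(2)])
  then have GZ: "G absolutely_integrable_on Z"
    by (rule measurable_bounded_by_integrable_imp_absolutely_integrable[OF _ Z(1)])
      (use bZ Gb in \<open>auto simp: absolutely_integrable_on_def\<close>)
  have der: "(\<psi> has_real_derivative w y) (at y within Z)" if "y \<in> Z" for y
    using that by (auto simp: Z_def intro: DERIV_subset)
  have inj: "inj_on \<psi> Z" by (rule inj_on_subset[OF inj_on_\<psi> Z(2)])
  have abs_w: "\<bar>w y\<bar> = w y" for y using w_ge_1[of y] by simp
  have transfer: "g absolutely_integrable_on {-1..1} \<and> integral {-1..1} g = integral Z G'"
    if "G' absolutely_integrable_on Z" and gG: "\<And>y. y \<in> Z \<Longrightarrow> w y * g (\<psi> y) = G' y" for g G'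
  proof -
    have "(\<lambda>y. \<bar>w y\<bar> * g (\<psi> y)) absolutely_integrable_on Z"
      by (rule absolutely_integrable_spike[OF that(1) negligible_empty]) (simp add: gG abs_w)
    moreover have "integral Z (\<lambda>y. \<bar>w y\<bar> * g (\<psi> y)) = integral Z G'"
      by (rule Henstock_Kurzweil_Integration.integral_cong) (simp add: gG abs_w)
    ultimately have *: "g absolutely_integrable_on (\<psi> ` Z)" "integral (\<psi> ` Z) g = integral Z G'"
      using has_absolute_integral_change_of_variables_1'[OF Z(1) der inj, of g "integral Z G'"] by auto
    have neg: "negligible {x \<in> {-1..1} - \<psi> ` Z. g x \<noteq> 0}"
      by (rule negligible_subset[OF Z_complement(2)]) blast
    have "{x \<in> \<psi> ` Z - {-1..1}. g x \<noteq> 0} = {}" using Z_sub by blast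
    then have neg': "negligible {x \<in> \<psi> ` Z - {-1..1}. g x \<noteq> 0}" by (simp only: negligible_empty)
    show ?thesis
      using * absolutely_integrable_spike_set[OF *(1) neg' neg] integral_spike_set[OF neg' neg] by simp
  qed
  have "f absolutely_integrable_on {-1..1}" using transfer[OF GZ fG] by blast
  have "(\<lambda>y. \<bar>G y\<bar>) absolutely_integrable_on Z" using GZ set_integrable_abs by blast
  moreover have "w y * \<bar>f (\<psi> y)\<bar> = \<bar>G y\<bar>" if "y \<in> Z" for y
    by (simp add: fG[OF that, symmetric] abs_mult abs_w)
  ultimately have "integral {-1..1} (\<lambda>x. \<bar>f x\<bar>) = integral Z (\<lambda>y. \<bar>G y\<bar>)"
    using transfer[of "\<lambda>y. \<bar>G y\<bar>" "\<lambda>x. \<bar>f x\<bar>"] by blast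
  also have "\<dots> \<le> integral Z b"
    using GZ bZ Gb by (intro integral_le) (auto simp: absolutely_integrable_on_def)
  also have "\<dots> \<le> integral {-1..1} b"
    using bZ b by (intro integral_subset_le Z) (auto simp: absolutely_integrable_on_def)
  finally show ?thesis using \<open>f absolutely_integrable_on {-1..1}\<close> by blast
qed

text \<open>
  The derivative of \<open>u \<circ> \<phi>\<close>.
\<close>
definition D :: "real \<Rightarrow> real" where "D x = h (\<phi> x) / w (\<phi> x)"

lemma D_\<psi>: "y \<in> Z \<Longrightarrow> D (\<psi> y) = h y / w y"
  using Z_sub[of y] by (simp add: D_def \<phi>_\<psi>)

lemma u_\<phi>_derivative:
  "negligible ({-1..1} - {x. ((\<lambda>x. u (\<phi> x)) has_real_derivative D x) (at x)})"
proof (rule negligible_subset[OF Z_complement(2)])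
  have "((\<lambda>x. u (\<phi> x)) has_real_derivative D (\<psi> y)) (at (\<psi> y))" if y: "y \<in> Z" for y
  proof -
    have y': "y \<in> {-1..1}" "\<psi> y \<in> {-1<..<1}" using y by (auto simp: Z_def)
    have "isCont \<phi> (\<psi> y)"
      using continuous_on_interior[OF continuous_on_\<phi>] y' by (simp add: interior_atLeastAtMost_real)
    then have "(\<phi> has_real_derivative inverse (w y)) (at (\<psi> y))"
      using y y' w_ge_1[of y] \<psi>_\<phi>
      by (intro DERIV_inverse_function[of \<psi> _ _ _ "-1" 1]) (auto simp: \<phi>_\<psi> Z_def)
    moreover have "(u has_real_derivative h y) (at (\<phi> (\<psi> y)))"
      using y y' by (simp add: \<phi>_\<psi> Z_def)
    ultimately have "((\<lambda>x. u (\<phi> x)) has_real_derivative h y * inverse (w y)) (at (\<psi> y))"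
      by (rule DERIV_chain2[rotated])
    then show ?thesis using D_\<psi>[OF y] by (simp add: divide_inverse)
  qed
  then show "{-1..1} - {x. ((\<lambda>x. u (\<phi> x)) has_real_derivative D x) (at x)} \<subseteq> {-1..1} - \<psi> ` Z"
    by blast
qed

end

section \<open>Convergence of the derivatives in the mean\<close>

text \<open>
  First \<open>f\<close> is truncated. The truncation is the pointwise limit of equally truncated continuous functions
  almost everywhere, and dominated convergence applies on the bounded interval.
\<close>
lemma continuous_L1_approximation:
  fixes f :: "real \<Rightarrow> real"
  assumes f: "f \<in> borel_measurable borel" "f absolutely_integrable_on {a..b}" and "e > 0"
  obtains g where "continuous_on UNIV g" "integral {a..b} (\<lambda>x. \<bar>f x - g x\<bar>) < e"
proof -
  let ?M = "lebesgue_on {a..b}"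
  define cl where "cl = (\<lambda>m r. max (- real m) (min (real m) r))"
  have cl_bound: "\<bar>cl m r\<bar> \<le> real m" for m r by (auto simp: cl_def)
  have f_int: "integrable ?M f" using f(2) by (intro absolutely_integrable_imp_integrable) auto
  then have [measurable]: "f \<in> borel_measurable ?M" by auto
  have cl_meas[measurable]: "cl m \<in> borel_measurable borel" for m unfolding cl_def by measurable
  have "(\<lambda>m. LINT x|?M. \<bar>f x - cl m (f x)\<bar>) \<longlonglongrightarrow> (LINT x|?M. 0)"
  proof (rule integral_dominated_convergence[where w="\<lambda>x. \<bar>f x\<bar>"])
    show "AE x in ?M. (\<lambda>m. \<bar>f x - cl m (f x)\<bar>) \<longlonglongrightarrow> 0"
    proof (rule AE_I2, rule tendsto_eventually)
      fix x
      obtain m0 where m0: "\<bar>f x\<bar> \<le> real m0" using real_arch_simple by blast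
      show "\<forall>\<^sub>F m in sequentially. \<bar>f x - cl m (f x)\<bar> = 0"
        using eventually_ge_at_top[of m0]
      proof eventually_elim
        case (elim m)
        then have "\<bar>f x\<bar> \<le> real m" using m0 by linarith
        then show ?case by (simp add: cl_def min_def max_def abs_le_iff)
      qed
    qed
    show "AE x in ?M. norm \<bar>f x - cl m (f x)\<bar> \<le> \<bar>f x\<bar>" for m
      by (auto simp: cl_def)
  qed (use f_int in auto)
  then have "\<forall>\<^sub>F m in sequentially. (LINT x|?M. \<bar>f x - cl m (f x)\<bar>) < e/2"
    using \<open>e > 0\<close> by (intro order_tendstoD(2)[where y=0]) auto
  then obtain m where m: "(LINT x|?M. \<bar>f x - cl m (f x)\<bar>) < e/2"
    by (auto simp: eventually_sequentially)
  have "f measurable_on UNIV"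
    by (rule lebesgue_measurable_imp_measurable_on)
      (use f(1) in \<open>auto intro!: measurable_completion\<close>)
  then obtain N g where g: "negligible N" "\<And>n. continuous_on UNIV (g n)"
    "\<And>x. x \<notin> N \<Longrightarrow> (\<lambda>n. g n x) \<longlonglongrightarrow> f x"
    unfolding measurable_on_def by auto
  have g_cont: "continuous_on S (\<lambda>x. cl m (g n x))" for n S
    unfolding cl_def by (intro continuous_intros continuous_on_subset[OF g(2)]) auto
  have [measurable]: "(\<lambda>x. cl m (g n x)) \<in> borel_measurable ?M" for n
    by (rule continuous_imp_measurable_on_sets_lebesgue[OF g_cont]) auto
  have fin: "finite_measure ?M" by (rule finite_measure_lebesgue_on) auto
  have "(\<lambda>n. LINT x|?M. \<bar>cl m (f x) - cl m (g n x)\<bar>) \<longlonglongrightarrow> (LINT x|?M. 0)"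
  proof (rule integral_dominated_convergence[where w="\<lambda>x. 2 * real m"])
    have "AE x in lebesgue. x \<notin> N"
      using g(1) by (intro AE_not_in) (simp add: negligible_iff_null_sets)
    then have "AE x in ?M. x \<notin> N" by (subst AE_restrict_space_iff) auto
    then show "AE x in ?M. (\<lambda>n. \<bar>cl m (f x) - cl m (g n x)\<bar>) \<longlonglongrightarrow> 0"
    proof eventually_elim
      case (elim x)
      have "(\<lambda>n. \<bar>cl m (f x) - cl m (g n x)\<bar>) \<longlonglongrightarrow> \<bar>cl m (f x) - cl m (f x)\<bar>"
        unfolding cl_def by (intro tendsto_intros g(3) elim)
      then show ?case by simp
    qed
    show "AE x in ?M. norm \<bar>cl m (f x) - cl m (g n x)\<bar> \<le> 2 * real m" for n
    proof (rule AE_I2)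
      fix x show "norm \<bar>cl m (f x) - cl m (g n x)\<bar> \<le> 2 * real m"
        using cl_bound[of m "f x"] cl_bound[of m "g n x"] by (simp add: abs_le_iff)
    qed
  qed (use finite_measure.integrable_const[OF fin] in auto)
  then have "\<forall>\<^sub>F n in sequentially. (LINT x|?M. \<bar>cl m (f x) - cl m (g n x)\<bar>) < e/2"
    using \<open>e > 0\<close> by (intro order_tendstoD(2)[where y=0]) auto
  then obtain n where n: "(LINT x|?M. \<bar>cl m (f x) - cl m (g n x)\<bar>) < e/2"
    by (auto simp: eventually_sequentially)
  have i1: "integrable ?M (\<lambda>x. cl m (f x))"
    by (rule finite_measure.integrable_const_bound[OF fin, where B="real m"]) (use cl_bound in auto)
  have i2: "integrable ?M (\<lambda>x. cl m (g n x))"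
    by (rule finite_measure.integrable_const_bound[OF fin, where B="real m"]) (use cl_bound in auto)
  have "(LINT x|?M. \<bar>f x - cl m (g n x)\<bar>)
      \<le> (LINT x|?M. \<bar>f x - cl m (f x)\<bar> + \<bar>cl m (f x) - cl m (g n x)\<bar>)"
    by (rule integral_mono) (use f_int i1 i2 in auto)
  also have "\<dots> = (LINT x|?M. \<bar>f x - cl m (f x)\<bar>) + (LINT x|?M. \<bar>cl m (f x) - cl m (g n x)\<bar>)"
    by (rule Bochner_Integration.integral_add) (use f_int i1 i2 in auto)
  also have "\<dots> < e" using m n by simp
  finally have "(LINT x|?M. \<bar>f x - cl m (g n x)\<bar>) < e" .
  moreover have "(LINT x|?M. \<bar>f x - cl m (g n x)\<bar>) = integral {a..b} (\<lambda>x. \<bar>f x - cl m (g n x)\<bar>)"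
    by (rule lebesgue_integral_eq_integral) (use f_int i2 in auto)
  ultimately show ?thesis using that[OF g_cont] by simp
qed

context reparametrization
begin

text \<open>
  For a continuous \<open>g\<close>, \<open>D - h\<close> is split as \<open>D - (g/w) \<circ> \<phi>\<close>, \<open>(g/w) \<circ> \<phi> - g \<circ> \<phi>\<close>, \<open>g \<circ> \<phi> - g\<close> and \<open>g - h\<close>.
  The substitution \<open>x = \<psi> y\<close> bounds the first by the integral of \<open>\<bar>h - g\<bar>\<close> and the second by that of
  \<open>M * (w - 1)\<close>; the third is small because \<open>\<phi>\<close> is close to the identity.
\<close>
lemma derivative_L1_bound:
  assumes g: "continuous_on {-1..1} g" and M: "\<And>x. x \<in> {-1..1} \<Longrightarrow> \<bar>g x\<bar> \<le> M"
    and osc: "\<And>s t. s \<in> {-1..1} \<Longrightarrow> t \<in> {-1..1} \<Longrightarrow> \<bar>s - t\<bar> \<le> V 1 / k \<Longrightarrow> \<bar>g s - g t\<bar> \<le> \<eta>"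
  shows "(\<lambda>x. D x - h x) absolutely_integrable_on {-1..1}" (is ?A)
    and "integral {-1..1} (\<lambda>x. \<bar>D x - h x\<bar>)
          \<le> 2 * integral {-1..1} (\<lambda>x. \<bar>h x - g x\<bar>) + M * (V 1 / k) + 2 * \<eta>" (is ?B)
proof -
  let ?I = "{-1..1::real}"
  have g_abs: "g absolutely_integrable_on ?I"
    by (rule absolutely_integrable_continuous_real[OF g])
  have hg_abs: "(\<lambda>x. h x - g x) absolutely_integrable_on ?I"
    by (rule set_integral_diff(1)[OF h_absolutely_integrable g_abs])
  have meas: "h \<in> borel_measurable (lebesgue_on ?I)" "g \<in> borel_measurable (lebesgue_on ?I)"
    by (rule absolutely_integrable_imp_borel_measurable[OF h_absolutely_integrable], simp)
      (rule absolutely_integrable_imp_borel_measurable[OF g_abs], simp)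
  define f1 where "f1 = (\<lambda>x. D x - g (\<phi> x) / w (\<phi> x))"
  define f2 where "f2 = (\<lambda>x. g (\<phi> x) / w (\<phi> x) - g (\<phi> x))"
  define f3 where "f3 = (\<lambda>x. g (\<phi> x) - g x)"
  have w0: "w y > 0" for y using w_ge_1[of y] by linarith
  have "f1 absolutely_integrable_on ?I \<and> integral ?I (\<lambda>x. \<bar>f1 x\<bar>) \<le> integral ?I (\<lambda>x. \<bar>h x - g x\<bar>)"
  proof (rule change_of_variables[where G="\<lambda>y. h y - g y"])
    show "w y * f1 (\<psi> y) = h y - g y" if "y \<in> Z" for y
      using Z_sub[OF that] w0[of y] by (simp add: f1_def D_\<psi>[OF that] \<phi>_\<psi> field_simps)
  qed (use hg_abs meas in \<open>auto simp: absolutely_integrable_on_def\<close>)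
  note f1 = this
  have V: "((\<lambda>x. M / k * \<bar>h x\<bar>) has_integral (M / k * (V 1 - V (-1)))) ?I"
    by (intro has_integral_mult_right V_integral) auto
  have "0 \<le> M" using M[of 0] by simp
  have "f2 absolutely_integrable_on ?I \<and> integral ?I (\<lambda>x. \<bar>f2 x\<bar>) \<le> integral ?I (\<lambda>x. M / k * \<bar>h x\<bar>)"
  proof (rule change_of_variables[where G="\<lambda>y. - (g y * (\<bar>h y\<bar> / k))"])
    show "w y * f2 (\<psi> y) = - (g y * (\<bar>h y\<bar> / k))" if "y \<in> Z" for y
    proof -
      have "w y * f2 (\<psi> y) = g y - w y * g y"
        using Z_sub[OF that] w0[of y] by (simp add: f2_def \<phi>_\<psi> field_simps)
      then show ?thesis by (simp add: w_def algebra_simps)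
    qed
    show "\<bar>- (g y * (\<bar>h y\<bar> / k))\<bar> \<le> M / k * \<bar>h y\<bar>" if "y \<in> Z" for y
      using mult_right_mono[OF M[of y], of "\<bar>h y\<bar> / k"] Z_sub[OF that] k_pos by (simp add: abs_mult)
  qed (use V meas k_pos \<open>0 \<le> M\<close> in auto)
  note f2 = this
  have f3_cont: "continuous_on ?I f3"
    unfolding f3_def using \<phi>_in by (intro continuous_intros g continuous_on_compose2[OF g continuous_on_\<phi>]) auto
  have "integral ?I (\<lambda>x. \<bar>f3 x\<bar>) \<le> integral ?I (\<lambda>x. \<eta>)"
  proof (rule integral_le)
    show "\<bar>f3 x\<bar> \<le> \<eta>" if "x \<in> ?I" for x
      unfolding f3_def by (rule osc[OF \<phi>_in[OF that] that \<phi>_near[OF that]])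
  qed (auto intro!: integrable_continuous_real continuous_intros f3_cont)
  then have f3: "f3 absolutely_integrable_on ?I" "integral ?I (\<lambda>x. \<bar>f3 x\<bar>) \<le> 2 * \<eta>"
    using absolutely_integrable_continuous_real[OF f3_cont] by auto
  have eq: "D x - h x = f1 x + f2 x + f3 x - (h x - g x)" for x
    by (simp add: f1_def f2_def f3_def)
  show ?A
    unfolding eq using f1 f2 f3 h_absolutely_integrable g_abs by (intro set_integral_add(1) set_integral_diff(1)) auto
  have abs: "(\<lambda>x. \<bar>f1 x\<bar>) integrable_on ?I" "(\<lambda>x. \<bar>f2 x\<bar>) integrable_on ?I"
    "(\<lambda>x. \<bar>f3 x\<bar>) integrable_on ?I" "(\<lambda>x. \<bar>h x - g x\<bar>) integrable_on ?I"
    using f1 f2 f3 hg_abs by (auto simp: absolutely_integrable_on_def)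
  have "integral ?I (\<lambda>x. \<bar>D x - h x\<bar>) \<le> integral ?I (\<lambda>x. \<bar>f1 x\<bar> + \<bar>f2 x\<bar> + \<bar>f3 x\<bar> + \<bar>h x - g x\<bar>)"
  proof (rule integral_le)
    show "(\<lambda>x. \<bar>D x - h x\<bar>) integrable_on ?I" using \<open>?A\<close> by (simp add: absolutely_integrable_on_def)
    show "\<bar>D x - h x\<bar> \<le> \<bar>f1 x\<bar> + \<bar>f2 x\<bar> + \<bar>f3 x\<bar> + \<bar>h x - g x\<bar>" for x
      unfolding eq by linarith
  qed (intro Henstock_Kurzweil_Integration.integrable_add abs)
  also have "\<dots> = integral ?I (\<lambda>x. \<bar>f1 x\<bar>) + integral ?I (\<lambda>x. \<bar>f2 x\<bar>) + integral ?I (\<lambda>x. \<bar>f3 x\<bar>)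
      + integral ?I (\<lambda>x. \<bar>h x - g x\<bar>)"
    by (simp add: Henstock_Kurzweil_Integration.integral_add Henstock_Kurzweil_Integration.integrable_add abs)
  also have "integral ?I (\<lambda>x. M / k * \<bar>h x\<bar>) = M * (V 1 / k)"
    using V by (simp add: has_integral_iff V_def)
  ultimately show ?B using f1 f2 f3 \<open>integral ?I (\<lambda>x. M / k * \<bar>h x\<bar>) = M * (V 1 / k)\<close> by linarith
qed

end

context function_with_density
begin

lemma reparametrization_Suc: "reparametrization u h (real (Suc n))"
  by unfold_locales simp

lemma V_over_Suc: "(\<lambda>n. c / real (Suc n)) \<longlonglongrightarrow> 0"
  using tendsto_mult_right_zero[OF LIMSEQ_inverse_real_of_nat, of c] by (simp add: divide_inverse)

lemma derivative_L1_convergence: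
  "(\<lambda>n. integral {-1..1} (\<lambda>x. \<bar>reparametrization.D h (real (Suc n)) x - h x\<bar>)) \<longlonglongrightarrow> 0"
    (is "?J \<longlonglongrightarrow> 0")
proof (rule LIMSEQ_I)
  fix e :: real assume "e > 0"
  then have "e / 8 > 0" by simp
  obtain g where g: "continuous_on UNIV g" "integral {-1..1} (\<lambda>x. \<bar>h x - g x\<bar>) < e / 8"
    by (rule continuous_L1_approximation[OF h_measurable h_absolutely_integrable[of "-1" 1] \<open>e / 8 > 0\<close>])
  have gI: "continuous_on {-1..1} g" by (rule continuous_on_subset[OF g(1)]) simp
  have "bounded (g ` {-1..1})"
    by (intro compact_imp_bounded compact_continuous_image gI) simp
  then obtain M where "\<forall>x\<in>{-1..1}. \<bar>g x\<bar> \<le> M"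
    unfolding bounded_iff by auto
  then have M: "\<bar>g x\<bar> \<le> M" if "x \<in> {-1..1}" for x using that by blast
  have "uniformly_continuous_on {-1..1} g"
    by (rule compact_uniformly_continuous[OF gI]) simp
  then obtain d where d: "d > 0"
    "\<And>s t. s \<in> {-1..1} \<Longrightarrow> t \<in> {-1..1} \<Longrightarrow> dist s t < d \<Longrightarrow> dist (g s) (g t) < e / 8"
    using \<open>e / 8 > 0\<close> unfolding uniformly_continuous_on_def by (metis dist_commute)
  have "\<forall>\<^sub>F n in sequentially. V 1 / real (Suc n) < d"
    by (rule order_tendstoD(2)[OF V_over_Suc d(1)])
  moreover have "\<forall>\<^sub>F n in sequentially. (M * V 1) / real (Suc n) < e / 4"
    by (rule order_tendstoD(2)[OF V_over_Suc]) (use \<open>e > 0\<close> in simp)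
  ultimately have "\<forall>\<^sub>F n in sequentially. norm (?J n - 0) < e"
  proof eventually_elim
    case (elim n)
    interpret R: reparametrization u h "real (Suc n)" by (rule reparametrization_Suc)
    have osc: "\<bar>g s - g t\<bar> \<le> e / 8"
      if "s \<in> {-1..1}" "t \<in> {-1..1}" "\<bar>s - t\<bar> \<le> V 1 / real (Suc n)" for s t
      using d(2)[OF that(1,2)] that(3) elim(1) by (simp add: dist_real_def)
    have "?J n \<le> 2 * integral {-1..1} (\<lambda>x. \<bar>h x - g x\<bar>) + M * (V 1 / real (Suc n)) + 2 * (e / 8)"
      by (rule R.derivative_L1_bound(2)[OF gI M osc])
    moreover have "M * (V 1 / real (Suc n)) < e / 4" using elim(2) by simp
    ultimately have "?J n < e" using g(2) \<open>e > 0\<close> by argo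
    moreover have "?J n \<ge> 0"
      using R.derivative_L1_bound(1)[OF gI M osc]
      by (intro Henstock_Kurzweil_Integration.integral_nonneg) (auto simp: absolutely_integrable_on_def)
    ultimately show ?case by simp
  qed
  then show "\<exists>N. \<forall>n\<ge>N. norm (?J n - 0) < e" by (simp add: eventually_sequentially)
qed

lemma uniform_convergence:
  assumes "e > 0"
  shows "\<forall>\<^sub>F n in sequentially. \<forall>x\<in>{-1..1}. \<bar>u (reparametrization.\<phi> h (real (Suc n)) x) - u x\<bar> < e"
proof -
  have "uniformly_continuous_on {-1..1} u"
    by (rule compact_uniformly_continuous[OF continuous_on_u]) simp
  then obtain d where d: "d > 0"
    "\<And>s t. s \<in> {-1..1} \<Longrightarrow> t \<in> {-1..1} \<Longrightarrow> dist s t < d \<Longrightarrow> dist (u s) (u t) < e"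
    using \<open>e > 0\<close> unfolding uniformly_continuous_on_def by (metis dist_commute)
  have "\<forall>\<^sub>F n in sequentially. V 1 / real (Suc n) < d"
    by (rule order_tendstoD(2)[OF V_over_Suc d(1)])
  then show ?thesis
  proof eventually_elim
    case (elim n)
    interpret R: reparametrization u h "real (Suc n)" by (rule reparametrization_Suc)
    show ?case
    proof
      fix x :: real assume x: "x \<in> {-1..1}"
      show "\<bar>u (R.\<phi> x) - u x\<bar> < e"
        using d(2)[OF R.\<phi>_in[OF x] x] R.\<phi>_near[OF x] elim by (simp add: dist_real_def)
    qed
  qed
qed

lemma function_L1_convergence:
  "(\<lambda>n. integral {-1..1} (\<lambda>x. \<bar>u (reparametrization.\<phi> h (real (Suc n)) x) - u x\<bar>)) \<longlonglongrightarrow> 0"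
    (is "?J \<longlonglongrightarrow> 0")
proof (rule LIMSEQ_I)
  fix e :: real assume "e > 0"
  then have "\<forall>\<^sub>F n in sequentially. \<forall>x\<in>{-1..1}. \<bar>u (reparametrization.\<phi> h (real (Suc n)) x) - u x\<bar> < e / 3"
    by (intro uniform_convergence) simp
  then have "\<forall>\<^sub>F n in sequentially. norm (?J n - 0) < e"
  proof eventually_elim
    case (elim n)
    interpret R: reparametrization u h "real (Suc n)" by (rule reparametrization_Suc)
    have int: "(\<lambda>x. \<bar>u (R.\<phi> x) - u x\<bar>) integrable_on {-1..1}"
      by (intro integrable_continuous_real continuous_intros continuous_on_u
          lipschitz_on_continuous_on[OF R.u_\<phi>_lipschitz])
    have "?J n \<le> integral {-1..1} (\<lambda>x::real. e / 3)"
      by (rule integral_le[OF int]) (use elim in \<open>auto intro: less_imp_le\<close>)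
    then have "?J n < e" using \<open>e > 0\<close> by simp
    moreover have "?J n \<ge> 0" by (rule Henstock_Kurzweil_Integration.integral_nonneg[OF int]) simp
    ultimately show ?case by simp
  qed
  then show "\<exists>N. \<forall>n\<ge>N. norm (?J n - 0) < e" by (simp add: eventually_sequentially)
qed

end

section \<open>Energies of the slowed-down functions\<close>

lemma frakF_measurable:
  assumes F: "F \<in> frakF" and p: "p \<in> borel_measurable M" "\<And>x. x \<in> space M \<Longrightarrow> 0 \<le> p x"
    and q: "q \<in> borel_measurable M" "\<And>x. x \<in> space M \<Longrightarrow> 0 \<le> q x"
  shows "(\<lambda>x. F (p x) (q x)) \<in> borel_measurable M"
proof -
  have "(\<lambda>(v, p). F v p) \<in> borel_measurable (restrict_space borel ({0..} \<times> {0..}))"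
    using F unfolding frakF_def by (intro borel_measurable_continuous_on_restrict) auto
  moreover have "(\<lambda>x. (p x, q x)) \<in> M \<rightarrow>\<^sub>M restrict_space borel ({0..} \<times> {0..})"
    using p q by (intro measurable_restrict_space2) auto
  ultimately have "(\<lambda>x. (\<lambda>(v, p). F v p) (p x, q x)) \<in> borel_measurable M"
    by (rule measurable_compose[rotated])
  then show ?thesis by simp
qed

lemma frakF_mono:
  assumes "F \<in> frakF" "0 \<le> v" "0 \<le> p" "p \<le> q"
  shows "F v p \<le> F v q"
proof -
  have "strict_mono_on {0..} (F v)" using assms unfolding frakF_def by auto
  then show ?thesis using assms strict_mono_onD[of "{0..}" "F v" p q] by (cases "p = q") auto
qed

lemma frakF_nonneg: "F \<in> frakF \<Longrightarrow> 0 \<le> v \<Longrightarrow> 0 \<le> p \<Longrightarrow> 0 \<le> F v p"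
  unfolding frakF_def by auto

text \<open>
  Convexity between the points \<open>0\<close> and \<open>p\<close>, with weight \<open>1 / s\<close> at \<open>p\<close>: passing the
  value \<open>v\<close> \<open>s\<close> times more slowly costs at most what standing still for the additional time costs.
\<close>
lemma frakF_perspective:
  assumes "F \<in> frakF" "0 \<le> v" "0 \<le> p" "1 \<le> s"
  shows "s * F v (p / s) \<le> F v p + (s - 1) * F v 0"
proof -
  have "convex_on {0..} (F v)" using assms unfolding frakF_def by auto
  then have "F v ((1 - 1 / s) *\<^sub>R 0 + (1 / s) *\<^sub>R p) \<le> (1 - 1 / s) * F v 0 + (1 / s) * F v p"
    using assms by (intro convex_onD) auto
  then have "s * F v (p / s) \<le> s * ((1 - 1 / s) * F v 0 + (1 / s) * F v p)"
    using assms by (intro mult_left_mono) auto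
  also have "\<dots> = F v p + (s - 1) * F v 0" using assms by (simp add: field_simps)
  finally show ?thesis .
qed

lemma weights_continuous_compose:
  assumes "a \<in> weights" "continuous_on S p" "continuous_on S q"
    and "\<And>x. x \<in> S \<Longrightarrow> p x \<in> {-1..1}" "\<And>x. x \<in> S \<Longrightarrow> 0 \<le> q x"
  shows "continuous_on S (\<lambda>x. a (p x) (q x))"
proof -
  have "continuous_on ({-1..1} \<times> {0..}) (\<lambda>(x, v). a x v)" using assms(1) by (simp add: weights_def)
  moreover have "continuous_on S (\<lambda>x. (p x, q x))" using assms(2,3) by (rule continuous_on_Pair)
  moreover have "(\<lambda>x. (p x, q x)) ` S \<subseteq> {-1..1} \<times> {0..}" using assms(4,5) by fastforce
  ultimately have "continuous_on S (\<lambda>x. (\<lambda>(x, v). a x v) (p x, q x))"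
    by (rule continuous_on_compose2)
  then show ?thesis by simp
qed

context reparametrization
begin

text \<open>
  \<open>\<psi>\<close> moves points only away from \<open>0\<close>, where the weight is largest, and does not cross \<open>0\<close>.
\<close>
lemma weight_decreases:
  assumes "\<And>v. v \<ge> 0 \<Longrightarrow> mono_on {-1..0} (\<lambda>x. a x v)"
    and "\<And>v. v \<ge> 0 \<Longrightarrow> antimono_on {0..1} (\<lambda>x. a x v)"
    and "y \<in> {-1..1}" "\<psi> y \<in> {-1..1}" "0 \<le> v"
  shows "a (\<psi> y) v \<le> a y v"
proof (cases "y \<le> 0")
  case True
  then show ?thesis using assms(3-5) \<psi>_le[of y] by (intro mono_onD[OF assms(1)]) auto
next
  case False
  then show ?thesis using assms(3-5) \<psi>_ge[of y] monotone_onD[OF assms(2)[OF assms(5)], of y "\<psi> y"] by auto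
qed

lemma energy_bound:
  assumes F: "F \<in> frakF" and a: "a \<in> weights"
    and mono: "\<And>v. v \<ge> 0 \<Longrightarrow> mono_on {-1..0} (\<lambda>x. a x v)"
    and antimono: "\<And>v. v \<ge> 0 \<Longrightarrow> antimono_on {0..1} (\<lambda>x. a x v)"
    and u0: "\<And>x. x \<in> {-1..1} \<Longrightarrow> 0 \<le> u x"
    and M: "\<And>x. x \<in> {-1..1} \<Longrightarrow> F (u x) 0 \<le> M"
    and fin: "(\<lambda>x. F (u x) (a x (u x) * \<bar>h x\<bar>)) integrable_on {-1..1}"
  shows "(\<lambda>x. F (u (\<phi> x)) (a x (u (\<phi> x)) * \<bar>D x\<bar>)) absolutely_integrable_on {-1..1} \<and>
    integral {-1..1} (\<lambda>x. \<bar>F (u (\<phi> x)) (a x (u (\<phi> x)) * \<bar>D x\<bar>)\<bar>)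
      \<le> integral {-1..1} (\<lambda>x. F (u x) (a x (u x) * \<bar>h x\<bar>)) + M * (V 1 / k)"
proof -
  let ?I = "{-1..1::real}"
  let ?b = "\<lambda>y. F (u y) (a y (u y) * \<bar>h y\<bar>) + M / k * \<bar>h y\<bar>"
  \<comment> \<open>Outside \<open>Z\<close>, \<open>\<psi> y\<close> may lie outside \<open>[-1,1]\<close>, where nothing is known about the weight.\<close>
  let ?cl = "\<lambda>x::real. max (-1) (min 1 x)"
  let ?q = "\<lambda>y. a (?cl (\<psi> y)) (u y) * (\<bar>h y\<bar> / w y)"
  have a0: "0 \<le> a x v" if "x \<in> ?I" "0 \<le> v" for x v
    using a that by (auto simp: weights_def)
  have w0: "w y > 0" for y using w_ge_1[of y] by linarith
  have M0: "0 \<le> M" using M[of 0] frakF_nonneg[OF F u0[of 0], of 0] by simp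
  have h_meas: "h \<in> borel_measurable (lebesgue_on ?I)"
    by (rule absolutely_integrable_imp_borel_measurable[OF h_absolutely_integrable]) simp
  have u_meas: "u \<in> borel_measurable (lebesgue_on ?I)"
    by (rule continuous_imp_measurable_on_sets_lebesgue[OF continuous_on_u]) simp
  have "continuous_on ?I (\<lambda>y. a (?cl (\<psi> y)) (u y))"
    by (rule weights_continuous_compose[OF a]) (auto intro!: continuous_intros continuous_on_\<psi> continuous_on_u u0)
  then have "(\<lambda>y. a (?cl (\<psi> y)) (u y)) \<in> borel_measurable (lebesgue_on ?I)"
    by (rule continuous_imp_measurable_on_sets_lebesgue) simp
  then have q_meas: "?q \<in> borel_measurable (lebesgue_on ?I)"
    using h_meas by (simp add: w_def)
  have V: "((\<lambda>x. M / k * \<bar>h x\<bar>) has_integral (M / k * (V 1 - V (-1)))) ?I"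
    by (intro has_integral_mult_right V_integral) auto
  have b_int: "?b integrable_on ?I"
    using fin V by (intro Henstock_Kurzweil_Integration.integrable_add) auto
  have "(\<lambda>x. F (u (\<phi> x)) (a x (u (\<phi> x)) * \<bar>D x\<bar>)) absolutely_integrable_on ?I \<and>
    integral ?I (\<lambda>x. \<bar>F (u (\<phi> x)) (a x (u (\<phi> x)) * \<bar>D x\<bar>)\<bar>) \<le> integral ?I ?b"
  proof (rule change_of_variables[where G="\<lambda>y. w y * F (u y) (?q y)"])
    have "(\<lambda>y. F (u y) (?q y)) \<in> borel_measurable (lebesgue_on ?I)"
      by (rule frakF_measurable[OF F u_meas _ q_meas]) (auto intro!: u0 mult_nonneg_nonneg a0 divide_nonneg_pos w0)
    then show "(\<lambda>y. w y * F (u y) (?q y)) \<in> borel_measurable (lebesgue_on ?I)"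
      using h_meas by (simp add: w_def)
    show "?b integrable_on ?I" by (rule b_int)
    show "0 \<le> ?b y" if "y \<in> ?I" for y
      using M0 k_pos that by (intro add_nonneg_nonneg frakF_nonneg[OF F] u0 mult_nonneg_nonneg a0) auto
    fix y assume y: "y \<in> Z"
    have yI: "y \<in> ?I" "\<psi> y \<in> ?I" using Z_sub[OF y] by auto
    then have cl: "?cl (\<psi> y) = \<psi> y" by auto
    have D: "\<bar>D (\<psi> y)\<bar> = \<bar>h y\<bar> / w y" using w0[of y] by (simp add: D_\<psi>[OF y])
    show "w y * F (u (\<phi> (\<psi> y))) (a (\<psi> y) (u (\<phi> (\<psi> y))) * \<bar>D (\<psi> y)\<bar>) = w y * F (u y) (?q y)"
      by (simp only: \<phi>_\<psi>[OF yI(1)] cl D)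
    have q0: "0 \<le> ?q y" unfolding cl
      using yI u0 w0[of y] by (intro mult_nonneg_nonneg a0 divide_nonneg_pos) auto
    have "F (u y) (?q y) \<le> F (u y) (a y (u y) * \<bar>h y\<bar> / w y)"
    proof (rule frakF_mono[OF F u0[OF yI(1)] q0])
      have "a (\<psi> y) (u y) * (\<bar>h y\<bar> / w y) \<le> a y (u y) * (\<bar>h y\<bar> / w y)"
        using w0[of y] by (intro mult_right_mono weight_decreases[OF mono antimono yI u0[OF yI(1)]]) auto
      then show "?q y \<le> a y (u y) * \<bar>h y\<bar> / w y" by (simp only: cl times_divide_eq_right)
    qed
    then have "w y * F (u y) (?q y) \<le> w y * F (u y) (a y (u y) * \<bar>h y\<bar> / w y)"
      using w0[of y] by (intro mult_left_mono) auto
    also have "\<dots> \<le> F (u y) (a y (u y) * \<bar>h y\<bar>) + (w y - 1) * F (u y) 0"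
      by (rule frakF_perspective[OF F u0[OF yI(1)] mult_nonneg_nonneg[OF a0[OF yI(1) u0[OF yI(1)]]] w_ge_1]) simp
    also have "(w y - 1) * F (u y) 0 \<le> (w y - 1) * M"
      using w_ge_1[of y] by (intro mult_left_mono M[OF yI(1)]) auto
    also have "(w y - 1) * M = M / k * \<bar>h y\<bar>" by (simp add: w_def)
    finally have "w y * F (u y) (?q y) \<le> ?b y" by simp
    moreover have "0 \<le> w y * F (u y) (?q y)"
      using w0[of y] by (intro mult_nonneg_nonneg frakF_nonneg[OF F u0[OF yI(1)] q0]) auto
    ultimately show "\<bar>w y * F (u y) (?q y)\<bar> \<le> ?b y" by simp
  qed
  moreover have "integral ?I ?b = integral ?I (\<lambda>x. F (u x) (a x (u x) * \<bar>h x\<bar>)) + M * (V 1 / k)"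
  proof -
    have "integral ?I ?b = integral ?I (\<lambda>x. F (u x) (a x (u x) * \<bar>h x\<bar>)) + integral ?I (\<lambda>x. M / k * \<bar>h x\<bar>)"
      using fin V by (intro Henstock_Kurzweil_Integration.integral_add) auto
    also have "integral ?I (\<lambda>x. M / k * \<bar>h x\<bar>) = M / k * (V 1 - V (-1))" by (rule integral_unique[OF V])
    finally show ?thesis by (simp add: V_def)
  qed
  ultimately show ?thesis by simp
qed

end

section \<open>The approximating sequence\<close>

lemma AE_deriv_eq:
  assumes "negligible ({-1..1} - {x. (v has_real_derivative d x) (at x)})"
  shows "AE x in lebesgue_on {-1..1}. deriv v x = d x"
proof -
  have "AE x in lebesgue. x \<notin> {-1..1} - {x. (v has_real_derivative d x) (at x)}"
    using assms by (intro AE_not_in) (simp add: negligible_iff_null_sets)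
  then have "AE x in lebesgue. x \<in> {-1..1} \<longrightarrow> deriv v x = d x"
    by eventually_elim (auto intro: DERIV_imp_deriv)
  then show ?thesis by (subst AE_restrict_space_iff) auto
qed

lemma energy_eq_nn_integral:
  assumes "AE x in lebesgue_on {-1..1}. deriv v x = d x"
  shows "energy F a v = (\<integral>\<^sup>+x. ennreal (F (v x) (a x (v x) * \<bar>d x\<bar>)) \<partial>lebesgue_on {-1..1})"
proof -
  have "energy F a v = (\<integral>\<^sup>+x. ennreal (F (v x) (a x (v x) * \<bar>deriv v x\<bar>)) \<partial>lebesgue_on {-1..1})"
    unfolding energy_def by (subst nn_integral_restrict_space) auto
  also have "\<dots> = (\<integral>\<^sup>+x. ennreal (F (v x) (a x (v x) * \<bar>d x\<bar>)) \<partial>lebesgue_on {-1..1})"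
    by (rule nn_integral_cong_AE) (use assms in eventually_elim, simp)
  finally show ?thesis .
qed

lemma W11_norm_eq_nn_integral:
  assumes "AE x in lebesgue_on {-1..1}. deriv v x = d x"
  shows "W11_norm v = (\<integral>\<^sup>+x. ennreal (\<bar>v x\<bar> + \<bar>d x\<bar>) \<partial>lebesgue_on {-1..1})"
proof -
  have "W11_norm v = (\<integral>\<^sup>+x. ennreal (\<bar>v x\<bar> + \<bar>deriv v x\<bar>) \<partial>lebesgue_on {-1..1})"
    unfolding W11_norm_def by (subst nn_integral_restrict_space) auto
  also have "\<dots> = (\<integral>\<^sup>+x. ennreal (\<bar>v x\<bar> + \<bar>d x\<bar>) \<partial>lebesgue_on {-1..1})"
    by (rule nn_integral_cong_AE) (use assms in eventually_elim, simp)
  finally show ?thesis .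
qed

lemma nn_integral_eq_HK_integral:
  fixes f :: "real \<Rightarrow> real"
  assumes "f absolutely_integrable_on {-1..1}" "\<And>x. x \<in> {-1..1} \<Longrightarrow> 0 \<le> f x"
  shows "(\<integral>\<^sup>+x. ennreal (f x) \<partial>lebesgue_on {-1..1}) = ennreal (integral {-1..1} f)"
proof -
  have int: "integrable (lebesgue_on {-1..1}) f"
    by (rule absolutely_integrable_imp_integrable[OF assms(1)]) simp
  then have "(\<integral>\<^sup>+x. ennreal (f x) \<partial>lebesgue_on {-1..1}) = ennreal (LINT x|lebesgue_on {-1..1}. f x)"
    by (rule nn_integral_eq_integral) (use assms(2) in auto)
  also have "(LINT x|lebesgue_on {-1..1}. f x) = integral {-1..1} f"
    by (rule lebesgue_integral_eq_integral[OF int]) simp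
  finally show ?thesis .
qed

text \<open>
  Also for \<open>L = \<infinity>\<close>, when the second assumption says nothing.
\<close>
lemma ennreal_tendsto_of_liminf:
  fixes E :: "nat \<Rightarrow> ennreal"
  assumes "L \<le> liminf E" "\<And>n. E n \<le> L + c n" "c \<longlonglongrightarrow> 0"
  shows "E \<longlonglongrightarrow> L"
proof -
  have "(\<lambda>n. L + c n) \<longlonglongrightarrow> L + 0" by (intro tendsto_add tendsto_const assms(3))
  then have "limsup (\<lambda>n. L + c n) = L + 0" by (rule lim_imp_Limsup[OF sequentially_bot])
  moreover have "limsup E \<le> limsup (\<lambda>n. L + c n)" by (intro Limsup_mono always_eventually allI assms(2))
  moreover have "liminf E \<le> limsup E" by (rule Liminf_le_Limsup) simp
  ultimately show ?thesis using assms(1) by (subst tendsto_iff_Liminf_eq_Limsup) auto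
qed

lemma frakF_continuous_tendsto:
  assumes F: "F \<in> frakF" and "p \<longlonglongrightarrow> p0" "q \<longlonglongrightarrow> q0" "\<And>n. 0 \<le> p n" "\<And>n. 0 \<le> q n"
  shows "(\<lambda>n. F (p n) (q n)) \<longlonglongrightarrow> F p0 q0"
proof -
  have c: "continuous_on ({0..} \<times> {0..}) (\<lambda>(v, p). F v p)" using F by (simp add: frakF_def)
  have "p0 \<ge> 0" "q0 \<ge> 0" using assms by (auto intro: LIMSEQ_le_const)
  then have "(\<lambda>n. (\<lambda>(v, p). F v p) (p n, q n)) \<longlonglongrightarrow> (\<lambda>(v, p). F v p) (p0, q0)"
    using assms by (intro continuous_on_tendsto_compose[OF c] tendsto_Pair) auto
  then show ?thesis by simp
qed

theorem lemma7:
  fixes F a :: "real \<Rightarrow> real \<Rightarrow> real" and u :: "real \<Rightarrow> real"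
  assumes "F \<in> frakF"
    and "a \<in> weights"
    and "\<And>v. v \<ge> 0 \<Longrightarrow> mono_on {-1..0} (\<lambda>x. a x v)"
    and "\<And>v. v \<ge> 0 \<Longrightarrow> antimono_on {0..1} (\<lambda>x. a x v)"
    and "u \<in> W11"
    and "\<And>x. x \<in> {-1..1} \<Longrightarrow> u x \<ge> 0"
  shows "\<exists>us :: nat \<Rightarrow> real \<Rightarrow> real.
           (\<forall>k. (\<exists>C. C-lipschitz_on {-1..1} (us k)) \<and> (\<forall>x\<in>{-1..1}. us k x \<ge> 0)) \<and>
           W11_tendsto us u \<and>
           (\<lambda>k. energy F a (us k)) \<longlonglongrightarrow> energy F a u"
proof -
  note F = assms(1) and a = assms(2) and mono = assms(3) and antimono = assms(4) and u0 = assms(6)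
  let ?I = "{-1..1::real}"
  let ?M = "lebesgue_on ?I"
  have "abs_continuous_on {-1..1} u" using assms(5) by (simp add: W11_def)
  then obtain h where h: "integrable lborel h"
    "\<And>x y. -1 \<le> x \<Longrightarrow> x \<le> y \<Longrightarrow> y \<le> 1 \<Longrightarrow> (h has_integral (u y - u x)) {x..y}"
    using abs_continuous_on_density[of "-1" 1 u] by auto
  interpret function_with_density u h by unfold_locales (rule h, rule h(2))
  have repar: "reparametrization u h (real (Suc n))" for n by (rule reparametrization_Suc)
  define \<phi> D where "\<phi> = (\<lambda>n. reparametrization.\<phi> h (real (Suc n)))"
    and "D = (\<lambda>n. reparametrization.D h (real (Suc n)))"
  have u_cont: "continuous_on ?I u" by (rule continuous_on_u)
  have a0: "0 \<le> a x v" if "x \<in> ?I" "0 \<le> v" for x v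
    using a that by (auto simp: weights_def)

  have lip: "(real (Suc n))-lipschitz_on ?I (\<lambda>x. u (\<phi> n x))" for n
    unfolding \<phi>_def by (rule reparametrization.u_\<phi>_lipschitz[OF repar])
  have \<phi>_in: "\<phi> n x \<in> ?I" if "x \<in> ?I" for n x
    unfolding \<phi>_def by (rule reparametrization.\<phi>_in[OF repar that])
  have v_cont: "continuous_on ?I (\<lambda>x. u (\<phi> n x))" for n
    by (rule lipschitz_on_continuous_on[OF lip])
  have v_neg: "negligible (?I - {x. ((\<lambda>x. u (\<phi> n x)) has_real_derivative D n x) (at x)})" for n
    unfolding \<phi>_def D_def by (rule reparametrization.u_\<phi>_derivative[OF repar])
  have u_neg: "negligible (?I - {x. (u has_real_derivative h x) (at x)})"
  proof -
    obtain N where N: "negligible N" "\<And>x. x \<in> {-1<..<1} - N \<Longrightarrow> (u has_real_derivative h x) (at x)"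
      using AE_has_derivative_of_density[OF h_integrable u_integral] by blast
    show ?thesis
    proof (rule negligible_subset)
      show "negligible (insert (-1) (insert 1 N))" using N(1) by simp
      show "?I - {x. (u has_real_derivative h x) (at x)} \<subseteq> insert (-1) (insert 1 N)"
        using N(2) by force
    qed
  qed
  have diff_neg: "negligible (?I - {x. ((\<lambda>x. u (\<phi> n x) - u x) has_real_derivative (D n x - h x)) (at x)})" for n
    by (rule negligible_subset[OF negligible_Un[OF v_neg[of n] u_neg]]) (auto intro: DERIV_diff)

  have diff_int: "(\<lambda>x. D n x - h x) absolutely_integrable_on ?I" for n
    unfolding D_def
    by (rule reparametrization.derivative_L1_bound(1)[OF repar[of n], of "\<lambda>_. 0" 0 0]) auto
  have D_meas: "D n \<in> borel_measurable ?M" for n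
  proof -
    have "(\<lambda>x. (D n x - h x) + h x) absolutely_integrable_on ?I"
      by (intro set_integral_add(1) diff_int h_absolutely_integrable)
    then have "D n absolutely_integrable_on ?I" by simp
    then show ?thesis by (rule absolutely_integrable_imp_borel_measurable) simp
  qed
  have h_meas: "h \<in> borel_measurable ?M"
    by (rule absolutely_integrable_imp_borel_measurable[OF h_absolutely_integrable]) simp
  have diff_abs: "(\<lambda>x. \<bar>D n x - h x\<bar>) absolutely_integrable_on ?I" for n
    using diff_int set_integrable_abs by blast
  have diff_conv: "(\<lambda>n. integral ?I (\<lambda>x. \<bar>D n x - h x\<bar>)) \<longlonglongrightarrow> 0"
    unfolding D_def by (rule derivative_L1_convergence)
  have v_conv: "(\<lambda>n. integral ?I (\<lambda>x. \<bar>u (\<phi> n x) - u x\<bar>)) \<longlonglongrightarrow> 0"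
    unfolding \<phi>_def by (rule function_L1_convergence)

  have "\<exists>r. strict_mono r \<and> (AE x in ?M. (\<lambda>n. D (r n) x - h x) \<longlonglongrightarrow> 0)"
  proof (rule tendsto_L1_AE_subseq)
    show int: "integrable ?M (\<lambda>x. D n x - h x)" for n
      by (rule absolutely_integrable_imp_integrable[OF diff_int]) simp
    have "(LINT x|?M. norm (D n x - h x)) = integral ?I (\<lambda>x. \<bar>D n x - h x\<bar>)" for n
      using lebesgue_integral_eq_integral[OF absolutely_integrable_imp_integrable[OF diff_abs]] by simp
    then show "(\<lambda>n. LINT x|?M. norm (D n x - h x)) \<longlonglongrightarrow> 0" using diff_conv by simp
  qed
  then obtain r where r: "strict_mono r" and D_conv: "AE x in ?M. (\<lambda>n. D (r n) x - h x) \<longlonglongrightarrow> 0"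
    by blast
  have \<phi>_conv: "(\<lambda>n. u (\<phi> (r n) x)) \<longlonglongrightarrow> u x" if "x \<in> ?I" for x
  proof -
    have "(\<lambda>n. u (\<phi> n x)) \<longlonglongrightarrow> u x"
    proof (rule LIMSEQ_I)
      fix e :: real assume "e > 0"
      from uniform_convergence[OF this] show "\<exists>N. \<forall>n\<ge>N. norm (u (\<phi> n x) - u x) < e"
        using that unfolding \<phi>_def eventually_sequentially real_norm_def by blast
    qed
    from LIMSEQ_subseq_LIMSEQ[OF this r] show ?thesis by (simp add: o_def)
  qed

  define us where "us = (\<lambda>n x. u (\<phi> (r n) x))"
  have "W11_tendsto us u"
  proof -
    let ?d = "\<lambda>n. integral ?I (\<lambda>x. \<bar>u (\<phi> n x) - u x\<bar>) + integral ?I (\<lambda>x. \<bar>D n x - h x\<bar>)"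
    have "W11_norm (\<lambda>x. u (\<phi> n x) - u x) = ennreal (?d n)" for n
    proof -
      have va: "(\<lambda>x. \<bar>u (\<phi> n x) - u x\<bar>) absolutely_integrable_on ?I"
        by (intro absolutely_integrable_continuous_real continuous_intros v_cont u_cont)
      have "W11_norm (\<lambda>x. u (\<phi> n x) - u x)
          = (\<integral>\<^sup>+x. ennreal (\<bar>u (\<phi> n x) - u x\<bar> + \<bar>D n x - h x\<bar>) \<partial>?M)"
        by (rule W11_norm_eq_nn_integral[OF AE_deriv_eq[OF diff_neg]])
      also have "\<dots> = ennreal (integral ?I (\<lambda>x. \<bar>u (\<phi> n x) - u x\<bar> + \<bar>D n x - h x\<bar>))"
        by (rule nn_integral_eq_HK_integral) (auto intro!: set_integral_add(1) va diff_abs)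
      also have "integral ?I (\<lambda>x. \<bar>u (\<phi> n x) - u x\<bar> + \<bar>D n x - h x\<bar>) = ?d n"
        using va diff_abs[of n]
        by (intro Henstock_Kurzweil_Integration.integral_add) (auto simp: absolutely_integrable_on_def)
      finally show ?thesis .
    qed
    moreover have "(\<lambda>n. ennreal (?d n)) \<longlonglongrightarrow> ennreal 0"
      using tendsto_add[OF v_conv diff_conv] by (intro tendsto_ennrealI) simp
    ultimately have "(\<lambda>n. W11_norm (\<lambda>x. u (\<phi> n x) - u x)) \<longlonglongrightarrow> 0" by simp
    from LIMSEQ_subseq_LIMSEQ[OF this r] show ?thesis
      by (simp add: W11_tendsto_def us_def o_def)
  qed

  moreover have "(\<lambda>n. energy F a (us n)) \<longlonglongrightarrow> energy F a u"
  proof -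
    define f where "f = (\<lambda>x. F (u x) (a x (u x) * \<bar>h x\<bar>))"
    define fn where "fn = (\<lambda>n x. F (u (\<phi> n x)) (a x (u (\<phi> n x)) * \<bar>D n x\<bar>))"
    have Eu: "energy F a u = (\<integral>\<^sup>+x. ennreal (f x) \<partial>?M)"
      unfolding f_def by (rule energy_eq_nn_integral[OF AE_deriv_eq[OF u_neg]])
    have Ev: "energy F a (us n) = (\<integral>\<^sup>+x. ennreal (fn (r n) x) \<partial>?M)" for n
      unfolding fn_def us_def by (rule energy_eq_nn_integral[OF AE_deriv_eq[OF v_neg]])
    have integrand_meas: "(\<lambda>x. F (v x) (a x (v x) * \<bar>d x\<bar>)) \<in> borel_measurable ?M"
      if v: "continuous_on ?I v" "\<And>x. x \<in> ?I \<Longrightarrow> 0 \<le> v x" and d: "d \<in> borel_measurable ?M" for v d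
    proof -
      have "v \<in> borel_measurable ?M"
        by (rule continuous_imp_measurable_on_sets_lebesgue[OF v(1)]) simp
      moreover have "(\<lambda>x. a x (v x)) \<in> borel_measurable ?M"
        by (rule continuous_imp_measurable_on_sets_lebesgue[OF weights_continuous_compose[OF a]])
          (use v in \<open>auto intro: continuous_intros\<close>)
      ultimately show ?thesis
        using d by (intro frakF_measurable[OF F]) (auto intro!: v(2) a0 mult_nonneg_nonneg)
    qed
    have f_meas: "f \<in> borel_measurable ?M"
      unfolding f_def by (rule integrand_meas[OF u_cont u0 h_meas])
    have fn_meas: "fn n \<in> borel_measurable ?M" for n
      unfolding fn_def by (rule integrand_meas[OF v_cont u0[OF \<phi>_in] D_meas])
    have f0: "0 \<le> f x" if "x \<in> ?I" for x
      unfolding f_def using that by (intro frakF_nonneg[OF F] mult_nonneg_nonneg a0 u0) auto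
    have fn0: "0 \<le> fn n x" if "x \<in> ?I" for n x
      unfolding fn_def using that by (intro frakF_nonneg[OF F] mult_nonneg_nonneg a0 u0 \<phi>_in) auto

    have "energy F a u \<le> liminf (\<lambda>n. energy F a (us n))"
    proof -
      have "AE x in ?M. (\<lambda>n. fn (r n) x) \<longlonglongrightarrow> f x"
        using D_conv AE_space
      proof eventually_elim
        case (elim x)
        then have x: "x \<in> ?I" by simp
        have "(\<lambda>n. D (r n) x) \<longlonglongrightarrow> h x" using elim(1) by (rule LIM_zero_cancel)
        moreover have "(\<lambda>n. a x (u (\<phi> (r n) x))) \<longlonglongrightarrow> a x (u x)"
        proof -
          have "continuous_on {0..} (a x)"
            by (rule weights_continuous_compose[OF a]) (use x in \<open>auto intro: continuous_intros\<close>)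
          then show ?thesis
            by (rule continuous_on_tendsto_compose) (use \<phi>_conv[OF x] u0 \<phi>_in[OF x] x in auto)
        qed
        ultimately show ?case unfolding fn_def f_def
          by (intro frakF_continuous_tendsto[OF F \<phi>_conv[OF x]] tendsto_intros)
             (use x in \<open>auto intro!: mult_nonneg_nonneg a0 u0 \<phi>_in simp del: atLeastAtMost_iff\<close>)
      qed
      then have "AE x in ?M. ennreal (f x) = liminf (\<lambda>n. ennreal (fn (r n) x))"
      proof eventually_elim
        case (elim x)
        then have "(\<lambda>n. ennreal (fn (r n) x)) \<longlonglongrightarrow> ennreal (f x)" by (rule tendsto_ennrealI)
        then show ?case by (intro lim_imp_Liminf[symmetric]) auto
      qed
      then have "energy F a u = (\<integral>\<^sup>+x. liminf (\<lambda>n. ennreal (fn (r n) x)) \<partial>?M)"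
        unfolding Eu by (rule nn_integral_cong_AE)
      also have "\<dots> \<le> liminf (\<lambda>n. \<integral>\<^sup>+x. ennreal (fn (r n) x) \<partial>?M)"
        by (rule nn_integral_liminf) (use fn_meas in simp)
      finally show ?thesis by (simp only: Ev)
    qed

    moreover obtain M where M: "\<And>x. x \<in> ?I \<Longrightarrow> F (u x) 0 \<le> M"
    proof -
      have "continuous_on ({0..} \<times> {0..}) (\<lambda>(v, p). F v p)" using F by (simp add: frakF_def)
      moreover have "continuous_on ?I (\<lambda>x. (u x, 0::real))" by (intro continuous_intros u_cont)
      moreover have "(\<lambda>x. (u x, 0::real)) ` ?I \<subseteq> {0..} \<times> {0..}" using u0 by fastforce
      ultimately have "continuous_on ?I (\<lambda>x. (\<lambda>(v, p). F v p) (u x, 0))"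
        by (rule continuous_on_compose2)
      then have "bounded ((\<lambda>x. F (u x) 0) ` ?I)"
        by (intro compact_imp_bounded compact_continuous_image) auto
      then obtain B where "\<forall>x\<in>?I. \<bar>F (u x) 0\<bar> \<le> B" unfolding bounded_iff by auto
      then show ?thesis by (intro that[of B]) (meson abs_le_D1)
    qed
    have "energy F a (us n) \<le> energy F a u + ennreal (M * (V 1 / real (Suc (r n))))" for n
    proof (cases "energy F a u = \<infinity>")
      case False
      have "integrable ?M f"
        by (rule integrableI_nonneg[OF f_meas]) (use f0 False Eu in \<open>auto simp: less_top\<close>)
      then have f_int: "f integrable_on ?I" by (rule integrable_on_lebesgue_on) simp
      have f_abs: "f absolutely_integrable_on ?I"
        using absolutely_integrable_on_iff_nonneg[of ?I f] f0 f_int by blast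
      have bound: "fn (r n) absolutely_integrable_on ?I \<and>
          integral ?I (\<lambda>x. \<bar>fn (r n) x\<bar>) \<le> integral ?I f + M * (V 1 / real (Suc (r n)))"
        using reparametrization.energy_bound[OF repar F a mono antimono u0 M f_int[unfolded f_def], of "r n"]
        by (simp only: fn_def f_def \<phi>_def D_def)
      have "integral ?I (fn (r n)) = integral ?I (\<lambda>x. \<bar>fn (r n) x\<bar>)"
        by (rule Henstock_Kurzweil_Integration.integral_cong) (use fn0 in simp)
      with bound have le: "integral ?I (fn (r n)) \<le> integral ?I f + M * (V 1 / real (Suc (r n)))" by simp
      have "0 \<le> M" using M[of 0] frakF_nonneg[OF F u0[of 0], of 0] by simp
      moreover have "0 \<le> V 1" using V_bounds[of 1] by simp
      moreover have "0 \<le> integral ?I f" using f0 f_int by (intro Henstock_Kurzweil_Integration.integral_nonneg)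
      moreover have "energy F a (us n) = ennreal (integral ?I (fn (r n)))"
        unfolding Ev by (rule nn_integral_eq_HK_integral) (use bound fn0 in auto)
      moreover have "energy F a u = ennreal (integral ?I f)"
        unfolding Eu by (rule nn_integral_eq_HK_integral[OF f_abs f0])
      ultimately show ?thesis using le by (simp flip: ennreal_plus)
    qed simp
    moreover have "(\<lambda>n. ennreal (M * (V 1 / real (Suc (r n))))) \<longlonglongrightarrow> 0"
    proof -
      have "(\<lambda>n. (M * V 1) / real (Suc (r n))) \<longlonglongrightarrow> 0"
        using LIMSEQ_subseq_LIMSEQ[OF V_over_Suc r, of "M * V 1"] by (simp add: o_def)
      then have "(\<lambda>n. ennreal ((M * V 1) / real (Suc (r n)))) \<longlonglongrightarrow> ennreal 0" by (rule tendsto_ennrealI)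
      then show ?thesis by simp
    qed
    ultimately show ?thesis by (rule ennreal_tendsto_of_liminf)
  qed
  moreover have "(\<exists>C. C-lipschitz_on ?I (us n)) \<and> (\<forall>x\<in>?I. us n x \<ge> 0)" for n
    unfolding us_def using lip u0 \<phi>_in by blast
  ultimately show ?thesis by blast
qed

end
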